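(* Let $k$ be a field, let $p,q\in\mathbb Z^+$ be relatively prime, and let $\{F_n\}_{n\in\mathbb N}$ be the $(p,q)$-Fibonacci sequence. Let $h,a,d\in\mathbb Z^+$ and $n\ge 3$, and let $\mathcal A=\{d_1,\ldots,d_n\}$ with $d_1:=F_a$ and $d_i:=F_{ha+(i-1)d}$ for all $i\in\{2,\ldots,n\}$. Then $I_{\mathcal A}$ is a complete intersection if and only if one of the following holds: (a) $d$ is odd; (b) $d\ge a$; (c) $a=2d$; (d) $\gcd\{a,d\}=a-d$ and $a$ is odd; or (e) $n=3$ and $2d\mid a$.
   Context: $\mathbb N$ denotes the nonnegative integers and $\mathbb Z^+$ the positive integers. The $(p,q)$-Fibonacci sequence is defined by $F_0=0$, $F_1=1$, $F_{n+2}=pF_{n+1}+qF_n$ for all $n\ge 0$. For $\mathcal A=\{d_1,\ldots,d_n\}\subset\mathbb Z^+$, the toric ideal $I_{\mathcal A}$ is the kernel of the $k$-algebra homomorphism $k[x_1,\ldots,x_n]\to k[t]$, $x_i\mapsto t^{d_i}$. It has height $n-1$; it is a complete intersection if its minimal number of generators equals $n-1$. *)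

theory Defs
  imports
    "HOL-Algebra.Ideal"
    "HOL-Library.Poly_Mapping"
    "HOL-Library.Extended_Nat"
    "HOL-Computational_Algebra.Polynomial"
begin

fun pq_fib :: "nat \<Rightarrow> nat \<Rightarrow> nat \<Rightarrow> nat" where
  "pq_fib p q 0 = 0"
| "pq_fib p q (Suc 0) = 1"
| "pq_fib p q (Suc (Suc n)) = p * pq_fib p q (Suc n) + q * pq_fib p q n"

section \<open>The ring \<open>k[x\<^sub>1, \<dots>, x\<^sub>n]\<close>\<close>

text \<open>
  A polynomial maps exponent vectors to coefficients, both with finite support; the
  multiplication of \<^type>\<open>poly_mapping\<close> is convolution. The type allows variables indexed
  by all natural numbers, and the carrier below keeps those with index in \<open>{1..n}\<close>.
\<close>

type_synonym 'k mpoly = "(nat \<Rightarrow>\<^sub>0 nat) \<Rightarrow>\<^sub>0 'k"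

definition mvar :: "nat \<Rightarrow> 'k::field mpoly" where
  "mvar i = Poly_Mapping.single (Poly_Mapping.single i 1) 1"

definition mconst :: "'k \<Rightarrow> 'k::field mpoly" where
  "mconst c = Poly_Mapping.single 0 c"

definition mpoly_ring :: "nat \<Rightarrow> ('k::field mpoly) ring" where
  "mpoly_ring n =
     \<lparr>carrier = {f. \<forall>m \<in> Poly_Mapping.keys f. Poly_Mapping.keys m \<subseteq> {1..n}},
      monoid.mult = (*), one = 1, zero = 0, add = (+)\<rparr>"

section \<open>Toric ideals\<close>

text \<open>
  The \<open>k\<close>-algebra homomorphism to \<open>k[t]\<close> with \<open>x\<^sub>i \<mapsto> t ^ w i\<close>, obtained by substitution into
  \<open>f = \<Sum>\<^sub>m c\<^sub>m x ^ m\<close>.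
\<close>

definition toric_map :: "(nat \<Rightarrow> nat) \<Rightarrow> 'k::field mpoly \<Rightarrow> 'k poly" where
  "toric_map w f =
     (\<Sum>m \<in> Poly_Mapping.keys f.
        [:Poly_Mapping.lookup f m:] *
        (\<Prod>i \<in> Poly_Mapping.keys m. (Polynomial.monom 1 (w i)) ^ Poly_Mapping.lookup m i))"

definition toric_ideal :: "nat \<Rightarrow> (nat \<Rightarrow> nat) \<Rightarrow> 'k::field mpoly set" where
  "toric_ideal n w = {f \<in> carrier (mpoly_ring n). toric_map w f = 0}"

text \<open>The value is \<open>\<infinity>\<close> exactly if \<open>I\<close> is not generated by a finite set.\<close>

definition min_num_generators :: "('a, 'b) ring_scheme \<Rightarrow> 'a set \<Rightarrow> enat" where
  "min_num_generators R I =
     (INF G \<in> {G. finite G \<and> G \<subseteq> carrier R \<and> genideal R G = I}. enat (card G))"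

text \<open>
  For positive weights \<open>w 1, \<dots>, w n\<close> the height of the toric ideal is \<open>n - 1\<close>.
  Weights are indexed by \<open>{1..n}\<close> and may repeat. The first argument fixes the field.
\<close>

definition toric_complete_intersection :: "'k::field itself \<Rightarrow> nat \<Rightarrow> (nat \<Rightarrow> nat) \<Rightarrow> bool" where
  "toric_complete_intersection _ n w \<longleftrightarrow>
     min_num_generators (mpoly_ring n) (toric_ideal n w :: 'k mpoly set) = enat (n - 1)"

section \<open>Basic facts\<close>

lemma mpoly_ring_simps [simp]:
  "f \<in> carrier (mpoly_ring n) \<longleftrightarrow>
     (\<forall>m \<in> Poly_Mapping.keys f. Poly_Mapping.keys m \<subseteq> {1..n})"
  "monoid.mult (mpoly_ring n) = (*)" "one (mpoly_ring n) = 1"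
  "zero (mpoly_ring n) = 0" "add (mpoly_ring n) = (+)"
  by (simp_all add: mpoly_ring_def)

lemma mpoly_ring_cring: "cring (mpoly_ring n :: ('k::field mpoly) ring)"
proof (rule cringI)
  show "abelian_group (mpoly_ring n :: ('k mpoly) ring)"
  proof (rule abelian_groupI)
    fix f g :: "'k mpoly"
    assume fg: "f \<in> carrier (mpoly_ring n)" "g \<in> carrier (mpoly_ring n)"
    show "f \<oplus>\<^bsub>mpoly_ring n\<^esub> g \<in> carrier (mpoly_ring n)"
      using fg Poly_Mapping.keys_add[of f g] unfolding mpoly_ring_simps by blast
  next
    fix f :: "'k mpoly" assume "f \<in> carrier (mpoly_ring n)"
    then show "\<exists>g\<in>carrier (mpoly_ring n). g \<oplus>\<^bsub>mpoly_ring n\<^esub> f = \<zero>\<^bsub>mpoly_ring n\<^esub>"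
      by (intro bexI[of _ "- f"]) (simp_all add: in_keys_iff)
  qed (simp_all add: add.assoc add.commute)
  show "comm_monoid (mpoly_ring n :: ('k mpoly) ring)"
  proof (rule comm_monoidI)
    fix f g :: "'k mpoly"
    assume fg: "f \<in> carrier (mpoly_ring n)" "g \<in> carrier (mpoly_ring n)"
    have "Poly_Mapping.keys m \<subseteq> {1..n}" if m: "m \<in> Poly_Mapping.keys (f * g)" for m
    proof -
      obtain a b where "m = a + b" "a \<in> Poly_Mapping.keys f" "b \<in> Poly_Mapping.keys g"
        using m Poly_Mapping.keys_mult[of f g] by blast
      then show ?thesis
        using fg Poly_Mapping.keys_add[of a b] unfolding mpoly_ring_simps by blast
    qed
    then show "f \<otimes>\<^bsub>mpoly_ring n\<^esub> g \<in> carrier (mpoly_ring n)" by simp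
  qed (simp_all add: mult.assoc mult.commute)
qed (simp add: distrib_right)

lemma toric_map_superset:
  assumes "finite S" "Poly_Mapping.keys f \<subseteq> S"
  shows "toric_map w f =
    (\<Sum>m\<in>S. [:Poly_Mapping.lookup f m:] *
       (\<Prod>i \<in> Poly_Mapping.keys m. (Polynomial.monom 1 (w i)) ^ Poly_Mapping.lookup m i))"
  unfolding toric_map_def
  by (rule sum.mono_neutral_left) (use assms in \<open>auto simp: in_keys_iff\<close>)

lemma toric_map_add: "toric_map w (f + g) = toric_map w f + toric_map w g"
proof -
  let ?S = "Poly_Mapping.keys f \<union> Poly_Mapping.keys g"
  let ?M = "\<lambda>m. \<Prod>i \<in> Poly_Mapping.keys m.
    (Polynomial.monom (1::'a) (w i)) ^ Poly_Mapping.lookup m i"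
  have "toric_map w (f + g) = (\<Sum>m\<in>?S. [:Poly_Mapping.lookup (f + g) m:] * ?M m)"
    by (rule toric_map_superset) (auto dest: set_mp[OF Poly_Mapping.keys_add])
  also have "\<dots> = (\<Sum>m\<in>?S. [:Poly_Mapping.lookup f m:] * ?M m + [:Poly_Mapping.lookup g m:] * ?M m)"
    by (rule sum.cong) (simp_all add: lookup_add smult_add_left)
  also have "\<dots> = toric_map w f + toric_map w g"
    unfolding sum.distrib by (subst (1 2) toric_map_superset[of ?S]) auto
  finally show ?thesis .
qed

lemma toric_map_zero: "toric_map w 0 = 0"
  by (simp add: toric_map_def)

lemma toric_map_single:
  "toric_map w (Poly_Mapping.single m c) =
     [:c:] * (\<Prod>i \<in> Poly_Mapping.keys m. (Polynomial.monom 1 (w i)) ^ Poly_Mapping.lookup m i)"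
  by (subst toric_map_superset[of "{m}"]) (auto split: if_splits)

lemma toric_map_mconst: "toric_map w (mconst c) = [:c:]"
  by (simp add: mconst_def toric_map_single)

lemma toric_map_mvar: "toric_map w (mvar i) = Polynomial.monom 1 (w i)"
  by (simp add: mvar_def toric_map_single)

lemma toric_map_sum: "toric_map w (sum f A) = (\<Sum>a\<in>A. toric_map w (f a))"
  by (induction A rule: infinite_finite_induct) (simp_all add: toric_map_zero toric_map_add)

lemma mpoly_expansion:
  "f = (\<Sum>m\<in>Poly_Mapping.keys f. Poly_Mapping.single m (Poly_Mapping.lookup f m))"
  by (rule poly_mapping_eqI)
    (simp add: lookup_sum lookup_single when_def in_keys_iff)

lemma toric_map_mult: "toric_map w (f * g) = toric_map w f * toric_map w g"
proof -
  let ?M = "\<lambda>m. \<Prod>i \<in> Poly_Mapping.keys m.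
    (Polynomial.monom (1::'a) (w i)) ^ Poly_Mapping.lookup m i"
  have sup: "?M m = (\<Prod>i\<in>S. (Polynomial.monom (1::'a) (w i)) ^ Poly_Mapping.lookup m i)"
    if "finite S" "Poly_Mapping.keys m \<subseteq> S" for S m
    by (rule prod.mono_neutral_left) (use that in \<open>auto simp: in_keys_iff\<close>)
  have M: "?M (a + b) = ?M a * ?M b" for a b
  proof -
    let ?S = "Poly_Mapping.keys a \<union> Poly_Mapping.keys b"
    have "?M (a + b) = (\<Prod>i\<in>?S. (Polynomial.monom (1::'a) (w i)) ^ Poly_Mapping.lookup (a + b) i)"
      by (rule sup) (auto dest: set_mp[OF Poly_Mapping.keys_add])
    also have "\<dots> = ?M a * ?M b"
      unfolding lookup_add power_add prod.distrib by (subst (1 2) sup[of ?S]) auto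
    finally show ?thesis .
  qed
  have single: "toric_map w (Poly_Mapping.single a c * Poly_Mapping.single b e) =
      toric_map w (Poly_Mapping.single a c) * toric_map w (Poly_Mapping.single b e)"
    for a b and c e :: 'a
    unfolding mult_single toric_map_single M by (simp add: mult_ac)
  let ?F = "\<lambda>f. \<Sum>m\<in>Poly_Mapping.keys f. Poly_Mapping.single m (Poly_Mapping.lookup f m)"
  have "toric_map w (?F f * ?F g) = toric_map w (?F f) * toric_map w (?F g)"
    by (simp only: sum_product toric_map_sum single)
  then show ?thesis
    by (simp only: mpoly_expansion[symmetric])
qed

end

theory Submission
  imports Defs "HOL-Library.Function_Algebras"
begin

text \<open>
  Write \<open>F\<close> for the sequence and \<open>L = F (d + 1) + q F (d - 1)\<close>; the terms with step \<open>d\<close> satisfy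
  \<open>F (m + 2 d) = L F (m + d) - (-q) ^ d F m\<close>. In cases (a) to (d) this recurrence, or the size of \<open>F a\<close>,
  puts all weights into the semigroup generated by the first two; in case (e) the relation
  \<open>L w 2 = w 3 + q ^ d F (h a)\<close> glues \<open>w 2\<close> to the pair \<open>w 1\<close>, \<open>w 3\<close>.

  Lower bounds for the number of generators of an ideal \<open>I\<close> come from additive maps \<open>\<Lambda>\<close> on \<open>I\<close> with
  \<open>\<Lambda> (g f) = \<epsilon> g \<Lambda> f\<close>: the span of \<open>\<Lambda> I\<close> has dimension at most that number. The gradient at
  \<open>(1, \<dots>, 1)\<close> gives the bound \<open>n - 1\<close>. For the bound \<open>n\<close> one reads off the coefficients of monomials that
  share no variable with any other monomial of the same degree. The least powers \<open>x\<^sub>i ^ c\<^sub>i\<close> whose degree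
  lies in the semigroup generated by the other weights are such monomials. If none of (a) to (e) holds, the
  degrees of these powers are distinct, except possibly when \<open>d\<close> divides \<open>a\<close> and \<open>n \<ge> 4\<close>; in
  that case the power of \<open>x\<^sub>1\<close> is replaced by a monomial in \<open>x\<^sub>2\<close> and \<open>x\<^sub>3\<close>.
\<close>

section \<open>Fibonacci and Lucas sequences\<close>

lemma pq_fib_add: "pq_fib p q (m + Suc n) = pq_fib p q (Suc m) * pq_fib p q (Suc n) + q * pq_fib p q m * pq_fib p q n"
proof (induction m arbitrary: n)
  case (Suc m)
  \<comment> \<open>One unit moves from the first index to the second, so the induction hypothesis
    is needed at \<open>Suc n\<close>.\<close>
  have "pq_fib p q (Suc m + Suc n) = pq_fib p q (m + Suc (Suc n))" by simp
  then show ?case unfolding Suc.IH by (simp add: algebra_simps)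
qed simp

section \<open>Positivity and growth\<close>

lemma pq_fib_pos: "p > 0 \<Longrightarrow> n > 0 \<Longrightarrow> pq_fib p q n > 0"
  by (induction p q n rule: pq_fib.induct) simp_all

lemma pq_fib_le_Suc: "p > 0 \<Longrightarrow> pq_fib p q n \<le> pq_fib p q (Suc n)"
  by (cases n) (simp_all add: trans_le_add1)

lemma pq_fib_mono: "p > 0 \<Longrightarrow> m \<le> n \<Longrightarrow> pq_fib p q m \<le> pq_fib p q n"
  using lift_Suc_mono_le[of "pq_fib p q" m n] pq_fib_le_Suc by blast

text \<open>The threshold 3 is sharp in general: \<open>F 2 = p\<close>, which equals
  \<open>F 1\<close> when \<open>p = 1\<close>.\<close>

lemma pq_fib_less:
  assumes "p > 0" "q > 0" "3 \<le> n" "m < n"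
  shows "pq_fib p q m < pq_fib p q n"
proof -
  obtain k where k: "n = Suc (Suc (Suc k))" using assms(3) by (metis add_Suc le_Suc_ex numeral_3_eq_3 plus_nat.add_0)
  have "pq_fib p q m \<le> pq_fib p q (Suc (Suc k))" using assms k by (intro pq_fib_mono) auto
  also have "\<dots> \<le> p * pq_fib p q (Suc (Suc k))" using assms by simp
  also have "\<dots> < p * pq_fib p q (Suc (Suc k)) + q * pq_fib p q (Suc k)"
    using assms pq_fib_pos[of p "Suc k" q] by simp
  finally show ?thesis using k by simp
qed

text \<open>Dropping the second summand of the addition formula leaves this product.\<close>

lemma pq_fib_mult_le: "p > 0 \<Longrightarrow> pq_fib p q m * pq_fib p q (Suc n) \<le> pq_fib p q (m + n)"
proof (cases m)
  case (Suc k)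
  assume "p > 0"
  have "pq_fib p q (n + Suc k) \<ge> pq_fib p q (Suc n) * pq_fib p q (Suc k)"
    by (subst pq_fib_add) simp
  then show ?thesis using Suc by (simp add: ac_simps)
qed simp

lemma pq_fib_mult_le': "p > 0 \<Longrightarrow> pq_fib p q m * pq_fib p q n \<le> pq_fib p q (m + n)"
  using pq_fib_mult_le[of p q m n] pq_fib_le_Suc[of p q n] by (meson le_trans mult_le_mono2)

section \<open>Coprimality and strong divisibility\<close>

lemma coprime_add_mult_left:
  fixes x y z :: nat
  assumes "coprime x y"
  shows "coprime (x + y * z) y"
  using assms by (meson coprimeI coprime_common_divisor dvd_add_left_iff dvd_triv_left gcd_nat.trans)

text \<open>Modulo \<open>q\<close> the term with index \<open>n + 1\<close> is
  \<open>p ^ n\<close>.\<close>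

lemma coprime_pq_fib_q:
  assumes "coprime p q"
  shows "coprime (pq_fib p q (Suc n)) q"
proof (induction n)
  case (Suc n)
  have "coprime (p * pq_fib p q (Suc n)) q" using Suc assms by simp
  from coprime_add_mult_left[OF this] show ?case by simp
qed simp

lemma coprime_pq_fib_Suc:
  assumes "coprime p q"
  shows "coprime (pq_fib p q n) (pq_fib p q (Suc n))"
proof (induction n)
  case (Suc n)
  have "coprime (q * pq_fib p q n) (pq_fib p q (Suc n))"
    using Suc coprime_pq_fib_q[OF assms, of n] by (simp add: coprime_commute)
  from coprime_add_mult_left[OF this, of p] show ?case
    by (simp add: coprime_commute add.commute mult.commute)
qed simp

text \<open>By the addition formula \<open>F (m + n)\<close> is congruent to
  \<open>F (m + 1) F n\<close> modulo \<open>F m\<close>, and \<open>F (m + 1)\<close> is coprime to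
  \<open>F m\<close>.\<close>

lemma gcd_pq_fib_add:
  assumes "coprime p q"
  shows "gcd (pq_fib p q m) (pq_fib p q (m + n)) = gcd (pq_fib p q m) (pq_fib p q n)"
proof (cases n)
  case (Suc k)
  have "pq_fib p q (m + n) = q * pq_fib p q k * pq_fib p q m + pq_fib p q (Suc m) * pq_fib p q n"
    unfolding Suc using pq_fib_add[of p q m k] by (simp only: ac_simps)
  then have "gcd (pq_fib p q m) (pq_fib p q (m + n))
      = gcd (pq_fib p q m) (q * pq_fib p q k * pq_fib p q m + pq_fib p q (Suc m) * pq_fib p q n)"
    by (simp only:)
  also have "\<dots> = gcd (pq_fib p q m) (pq_fib p q (Suc m) * pq_fib p q n)"
    by (rule gcd_add_mult)
  also have "\<dots> = gcd (pq_fib p q m) (pq_fib p q n)"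
    using coprime_pq_fib_Suc[OF assms, of m] by (simp only: gcd_mult_right_left_cancel)
  finally show ?thesis .
qed simp

text \<open>The subtractive Euclidean algorithm runs on the indices; \<open>gcd_pq_fib_add\<close>
  is one step of it.\<close>

lemma pq_fib_gcd:
  assumes "coprime p q"
  shows "gcd (pq_fib p q m) (pq_fib p q n) = pq_fib p q (gcd m n)"
proof (induction "m + n" arbitrary: m n rule: less_induct)
  case less
  have *: "gcd (pq_fib p q m) (pq_fib p q n) = pq_fib p q (gcd m n)"
    if "m \<le> n" "m > 0" "\<And>i j. i + j < m + n \<Longrightarrow> gcd (pq_fib p q i) (pq_fib p q j) = pq_fib p q (gcd i j)" for m n
  proof -
    define k where "k = n - m"
    have k: "n = m + k" using that(1) unfolding k_def by simp
    have "gcd (pq_fib p q m) (pq_fib p q n) = gcd (pq_fib p q m) (pq_fib p q k)"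
      unfolding k by (rule gcd_pq_fib_add[OF assms])
    also have "\<dots> = pq_fib p q (gcd m k)" by (rule that(3)) (use that(2) k in simp)
    finally show ?thesis using k by simp
  qed
  consider "m = 0" | "n = 0" | "m > 0" "m \<le> n" | "n > 0" "n \<le> m" by linarith
  then show ?case
  proof cases
    case 3
    show ?thesis by (rule *[OF 3(2,1)]) (rule less)
  next
    case 4
    have "gcd (pq_fib p q n) (pq_fib p q m) = pq_fib p q (gcd n m)"
      by (rule *[OF 4(2,1)]) (rule less, simp add: add.commute)
    then show ?thesis by (simp add: gcd.commute)
  qed simp_all
qed

lemma pq_fib_dvd:
  assumes "coprime p q" "m dvd n"
  shows "pq_fib p q m dvd pq_fib p q n"
  using pq_fib_gcd[OF assms(1), of m n] assms(2) by (metis gcd_dvd2 gcd_nat.absorb1)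

text \<open>The left side is a 2 by 2 determinant of consecutive terms; raising both indices by one
  applies the recurrence matrix, whose determinant is \<open>- q\<close>.\<close>

lemma pq_fib_dOcagne:
  "int (pq_fib p q (m + k)) * int (pq_fib p q (Suc k)) - int (pq_fib p q (m + Suc k)) * int (pq_fib p q k)
    = (- int q) ^ k * int (pq_fib p q m)"
proof (induction k)
  case (Suc k)
  have "int (pq_fib p q (m + Suc k)) * int (pq_fib p q (Suc (Suc k)))
      - int (pq_fib p q (m + Suc (Suc k))) * int (pq_fib p q (Suc k))
    = - int q * (int (pq_fib p q (m + k)) * int (pq_fib p q (Suc k)) - int (pq_fib p q (m + Suc k)) * int (pq_fib p q k))"
    by (simp add: algebra_simps)
  also have "\<dots> = (- int q) ^ Suc k * int (pq_fib p q m)"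
    unfolding Suc by simp
  finally show ?case .
qed simp

text \<open>The companion Lucas sequence: the sum of the \<open>d\<close>-th powers of the two roots
  of \<open>X^2 = p X + q\<close>. This reading is valid for \<open>d > 0\<close>; at
  \<open>d = 0\<close> truncated subtraction gives 1 instead of 2.\<close>

definition pq_lucas :: "nat \<Rightarrow> nat \<Rightarrow> nat \<Rightarrow> nat" where
  "pq_lucas p q d = pq_fib p q (Suc d) + q * pq_fib p q (d - 1)"

text \<open>The \<open>d\<close>-th powers of the characteristic roots have sum \<open>L\<close> and
  product \<open>(-q) ^ d\<close>, so steps of length \<open>d\<close> obey this recurrence. The
  proof combines the addition formula with the determinant identity. The parity of \<open>d\<close>
  decides the sign of the last term, and with it the course of the whole argument.\<close>

lemma pq_fib_step:
  assumes "d > 0"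
  shows "int (pq_fib p q (m + 2 * d)) =
    int (pq_lucas p q d) * int (pq_fib p q (m + d)) - (- int q) ^ d * int (pq_fib p q m)"
proof -
  obtain k where k: "d = Suc k" using assms by (cases d) auto
  have "m + 2 * d = (m + k) + Suc (Suc k)" using k by simp
  then have "pq_fib p q (m + 2 * d) =
      pq_fib p q (m + d) * pq_fib p q (Suc d) + q * pq_fib p q (m + k) * pq_fib p q d"
    using pq_fib_add[of p q "m + k" "Suc k"] k by (simp only: add_Suc_right)
  then have A: "int (pq_fib p q (m + 2 * d)) =
      int (pq_fib p q (m + d)) * int (pq_fib p q (Suc d)) + int q * int (pq_fib p q (m + k)) * int (pq_fib p q d)"
    by simp
  show ?thesis
    using A pq_fib_dOcagne[of p q m k] unfolding pq_lucas_def k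
    by (simp add: algebra_simps)
qed

lemma pq_fib_double: "d > 0 \<Longrightarrow> pq_fib p q (2 * d) = pq_lucas p q d * pq_fib p q d"
  using pq_fib_step[of d p q 0] by (simp flip: of_nat_mult)

text \<open>This is \<open>pq_fib_step\<close> started at the index \<open>s - d\<close>, rewritten
  by the reflection \<open>F (-k) = - (-q) ^ (-k) F k\<close> so that only nonnegative indices
  occur.\<close>

lemma pq_fib_add_lucas:
  assumes "0 < s" "s \<le> d"
  shows "int (pq_fib p q (d + s)) =
    int (pq_lucas p q d) * int (pq_fib p q s) + (- int q) ^ s * int (pq_fib p q (d - s))"
proof -
  obtain k where k: "s = Suc k" using assms by (cases s) auto
  obtain m where m: "d = m + Suc k" using assms k by (metis add.commute le_Suc_ex)
  have "int (pq_fib p q (d + s)) = int (pq_fib p q (Suc d)) * int (pq_fib p q s) + int q * int (pq_fib p q d) * int (pq_fib p q k)"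
    using pq_fib_add[of p q d k] k by simp
  then show ?thesis
    using pq_fib_dOcagne[of p q m k] unfolding pq_lucas_def k m
    by (simp add: algebra_simps)
qed

text \<open>Each of the two summands of \<open>L\<close> times \<open>F m\<close> appears in one
  form of the addition formula for \<open>F (m + d)\<close>.\<close>

lemma pq_lucas_mult_le: "d > 0 \<Longrightarrow> pq_lucas p q d * pq_fib p q m \<le> 2 * pq_fib p q (m + d)"
proof (cases m)
  case (Suc k)
  assume "d > 0"
  then obtain j where j: "d = Suc j" by (cases d) auto
  have "pq_fib p q (m + d) \<ge> q * pq_fib p q m * pq_fib p q j"
    unfolding j pq_fib_add by simp
  moreover have "pq_fib p q (d + m) \<ge> pq_fib p q (Suc d) * pq_fib p q m"
    unfolding Suc pq_fib_add by simp
  ultimately show ?thesis unfolding pq_lucas_def j by (simp add: algebra_simps)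
qed simp

text \<open>For even \<open>d\<close> this says that \<open>X^2 - L X + q ^ d\<close> has real
  roots. With \<open>L = A + B\<close>, the determinant identity gives
  \<open>A B = q (F d)^2 + q ^ d\<close>, and \<open>4 A B <= (A + B)^2\<close>.\<close>

lemma four_power_le_pq_lucas:
  assumes "even d" "d > 0"
  shows "4 * q ^ d \<le> pq_lucas p q d ^ 2"
proof -
  obtain k where k: "d = Suc k" using assms by (cases d) auto
  define A B where "A = int (pq_fib p q (Suc d))" and "B = int q * int (pq_fib p q k)"
  have "int (pq_fib p q (Suc d)) * int (pq_fib p q k) = int (pq_fib p q d)^2 + int q ^ k"
    using pq_fib_dOcagne[of p q 1 k] assms k by (simp add: algebra_simps power2_eq_square)
  then have "int q * (int (pq_fib p q (Suc d)) * int (pq_fib p q k)) = int q * (int (pq_fib p q d)^2 + int q ^ k)"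
    by (rule arg_cong)
  then have *: "A * B = int q * int (pq_fib p q d)^2 + int q ^ d"
    unfolding A_def B_def k by (simp only: distrib_left mult.left_commute power_Suc)
  have "4 * int q ^ d \<le> 4 * (A * B)" unfolding * by simp
  also have "\<dots> \<le> (A + B)^2" using sum_squares_ge_zero[of "A - B" 0]
    by (simp add: power2_eq_square algebra_simps)
  finally have "int (4 * q ^ d) \<le> int (pq_lucas p q d ^ 2)"
    unfolding A_def B_def pq_lucas_def k by simp
  then show ?thesis by linarith
qed

lemma coprime_pq_lucas_q: "coprime p q \<Longrightarrow> coprime (pq_lucas p q d) q"
  unfolding pq_lucas_def by (intro coprime_add_mult_left coprime_pq_fib_q)

lemma pq_lucas_ge_3:
  assumes "p > 0" "q > 0" "d \<ge> 2"
  shows "pq_lucas p q d \<ge> 3"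
proof -
  have "pq_fib p q 3 \<le> pq_fib p q (Suc d)" using assms by (intro pq_fib_mono) auto
  moreover have "pq_fib p q 3 = p * p + q" by (simp add: numeral_3_eq_3)
  moreover have "p * p > 0" using assms by simp
  moreover have "q * pq_fib p q (d - 1) > 0" using assms pq_fib_pos[of p "d-1" q] by simp
  ultimately show ?thesis using assms(2) unfolding pq_lucas_def by linarith
qed

lemma pq_lucas_le_double:
  assumes "p > 0" "d > 0"
  shows "pq_lucas p q d \<le> pq_fib p q (2 * d)"
  using pq_fib_double[OF assms(2), of p q] pq_fib_pos[OF assms, of q] by simp

section \<open>Generators of toric ideals\<close>

text \<open>The elements of the ideal whose image under \<open>\<Lambda>\<close> lies in the span of
  the images of \<open>G\<close> form an ideal containing \<open>G\<close>, hence are everything.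
  The unit vectors indexed by \<open>T\<close> then lie in a span of at most \<open>card G\<close>
  vectors.\<close>

lemma card_generators_ge:
  fixes \<Lambda> :: "'a \<Rightarrow> 't \<Rightarrow> 'k::field" and \<epsilon> :: "'a \<Rightarrow> 'k"
  assumes "ring R" and G: "finite G" "G \<subseteq> carrier R"
    and "finite T"
    and add: "\<And>f g. f \<in> genideal R G \<Longrightarrow> g \<in> genideal R G \<Longrightarrow> \<Lambda> (f \<oplus>\<^bsub>R\<^esub> g) = (\<lambda>t. \<Lambda> f t + \<Lambda> g t)"
    and left: "\<And>f r. f \<in> genideal R G \<Longrightarrow> r \<in> carrier R \<Longrightarrow> \<Lambda> (r \<otimes>\<^bsub>R\<^esub> f) = (\<lambda>t. \<epsilon> r * \<Lambda> f t)"
    and right: "\<And>f r. f \<in> genideal R G \<Longrightarrow> r \<in> carrier R \<Longrightarrow> \<Lambda> (f \<otimes>\<^bsub>R\<^esub> r) = (\<lambda>t. \<epsilon> r * \<Lambda> f t)"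
    and unit: "\<And>t. t \<in> T \<Longrightarrow> \<exists>f \<in> genideal R G. \<Lambda> f t \<noteq> 0 \<and> (\<forall>s\<in>T - {t}. \<Lambda> f s = 0)"
  shows "card T \<le> card G"
proof -
  interpret ring R by fact
  define I where "I = genideal R G"
  interpret I: ideal I R unfolding I_def by (rule genideal_ideal) (rule G)
  interpret V: vector_space "\<lambda>(c::'k) (v::'t \<Rightarrow> 'k) t. c * v t"
    by unfold_locales (auto simp: fun_eq_iff algebra_simps)
  \<comment> \<open>Cutting off outside \<open>T\<close> turns the elements given by
    \<open>unit\<close> into exact multiples of unit vectors.\<close>
  define \<Lambda>' where "\<Lambda>' f = (\<lambda>t. if t \<in> T then \<Lambda> f t else 0)" for f
  define W where "W = V.span (\<Lambda>' ` G)"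
  define J where "J = {f \<in> I. \<Lambda>' f \<in> W}"
  have left': "\<Lambda>' (r \<otimes>\<^bsub>R\<^esub> f) = (\<lambda>t. \<epsilon> r * \<Lambda>' f t)"
    and right': "\<Lambda>' (f \<otimes>\<^bsub>R\<^esub> r) = (\<lambda>t. \<epsilon> r * \<Lambda>' f t)" if "f \<in> I" "r \<in> carrier R" for f r
    using left right that unfolding \<Lambda>'_def I_def by (auto simp: fun_eq_iff)
  have add': "\<Lambda>' (f \<oplus>\<^bsub>R\<^esub> g) = \<Lambda>' f + \<Lambda>' g" if "f \<in> I" "g \<in> I" for f g
    using add that unfolding \<Lambda>'_def I_def by (auto simp: fun_eq_iff)
  have J_left: "r \<otimes>\<^bsub>R\<^esub> f \<in> J" and J_right: "f \<otimes>\<^bsub>R\<^esub> r \<in> J" if "f \<in> J" "r \<in> carrier R" for f r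
    using that left'[of f r] right'[of f r] V.span_scale[of "\<Lambda>' f" "\<Lambda>' ` G" "\<epsilon> r"]
      I.I_l_closed I.I_r_closed
    unfolding J_def W_def by auto
  have "ideal J R"
  proof (rule idealI[OF \<open>ring R\<close>])
    show "subgroup J (add_monoid R)"
    proof (rule add.subgroupI)
      show "J \<subseteq> carrier R" unfolding J_def using I.Icarr by auto
      have "\<Lambda>' \<zero>\<^bsub>R\<^esub> = \<Lambda>' \<zero>\<^bsub>R\<^esub> + \<Lambda>' \<zero>\<^bsub>R\<^esub>" using add'[of "\<zero>\<^bsub>R\<^esub>" "\<zero>\<^bsub>R\<^esub>"] I.zero_closed by simp
      then have "\<Lambda>' \<zero>\<^bsub>R\<^esub> = 0" by simp
      then have "\<zero>\<^bsub>R\<^esub> \<in> J" unfolding J_def W_def using V.span_zero I.zero_closed by simp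
      then show "J \<noteq> {}" by blast
      show "\<ominus>\<^bsub>R\<^esub> f \<in> J" if "f \<in> J" for f
      proof -
        have "f \<in> carrier R" using that unfolding J_def using I.Icarr by auto
        then have "\<ominus>\<^bsub>R\<^esub> f = (\<ominus>\<^bsub>R\<^esub> \<one>\<^bsub>R\<^esub>) \<otimes>\<^bsub>R\<^esub> f" by (simp add: l_minus)
        then show ?thesis using J_left[OF that, of "\<ominus>\<^bsub>R\<^esub> \<one>\<^bsub>R\<^esub>"] by simp
      qed
      show "f \<oplus>\<^bsub>R\<^esub> g \<in> J" if "f \<in> J" "g \<in> J" for f g
        using that add'[of f g] V.span_add unfolding J_def W_def
        by (auto intro: I.a_closed)
    qed
  qed (use J_left J_right in auto)
  moreover have "G \<subseteq> J"
    using genideal_self[OF G(2)] V.span_superset[of "\<Lambda>' ` G"] unfolding J_def W_def I_def by auto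
  ultimately have "I \<subseteq> J" unfolding I_def by (rule genideal_minimal)
  define e where "e t = (\<lambda>s. if s = t then 1 else 0 :: 'k)" for t :: 't
  have sum_app: "(\<Sum>x\<in>A. h x) t = (\<Sum>x\<in>A. h x t)" for A and h :: "('t \<Rightarrow> 'k) \<Rightarrow> 't \<Rightarrow> 'k" and t
    by (induction A rule: infinite_finite_induct) auto
  have inj: "inj_on e T" by (rule inj_onI) (auto simp: e_def fun_eq_iff split: if_splits)
  have "e t \<in> W" if t: "t \<in> T" for t
  proof -
    obtain f where f: "f \<in> I" "\<Lambda> f t \<noteq> 0" "\<forall>s\<in>T - {t}. \<Lambda> f s = 0"
      using unit[OF t] unfolding I_def by blast
    have "\<Lambda>' f \<in> W" using f \<open>I \<subseteq> J\<close> unfolding J_def by auto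
    moreover have "e t = (\<lambda>s. inverse (\<Lambda> f t) * \<Lambda>' f s)"
      using f t by (auto simp: e_def \<Lambda>'_def fun_eq_iff)
    ultimately show ?thesis unfolding W_def using V.span_scale by metis
  qed
  then have sub: "e ` T \<subseteq> V.span (\<Lambda>' ` G)" unfolding W_def by auto
  have "V.independent (e ` T)"
  proof (rule V.independent_if_scalars_zero)
    show "finite (e ` T)" using \<open>finite T\<close> by simp
    fix u x assume sum: "(\<Sum>x\<in>e ` T. (\<lambda>t. u x * x t)) = 0" and "x \<in> e ` T"
    then obtain t where t: "t \<in> T" "x = e t" by auto
    have "0 = (\<Sum>x\<in>e ` T. (\<lambda>t. u x * x t)) t" using sum by simp
    also have "\<dots> = (\<Sum>x\<in>e ` T. u x * x t)" by (rule sum_app)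
    also have "\<dots> = (\<Sum>s\<in>T. u (e s) * e s t)" by (simp add: sum.reindex[OF inj])
    also have "\<dots> = (\<Sum>s\<in>{t}. u (e s) * e s t)"
      by (rule sum.mono_neutral_right) (use t \<open>finite T\<close> in \<open>auto simp: e_def\<close>)
    finally show "u x = 0" using t by (simp add: e_def)
  qed
  then have "card (e ` T) \<le> card (\<Lambda>' ` G)"
    using V.independent_span_bound[OF _ _ sub] G(1) by blast
  also have "\<dots> \<le> card G" using G(1) by (rule card_image_le)
  finally show ?thesis using card_image[OF inj] by simp
qed

section \<open>Linear functionals on polynomials\<close>

definition lin_ext :: "((nat \<Rightarrow>\<^sub>0 nat) \<Rightarrow> 'k) \<Rightarrow> 'k::field mpoly \<Rightarrow> 'k" where
  "lin_ext \<phi> f = (\<Sum>m\<in>Poly_Mapping.keys f. Poly_Mapping.lookup f m * \<phi> m)"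

lemma lin_ext_superset:
  "finite S \<Longrightarrow> Poly_Mapping.keys f \<subseteq> S \<Longrightarrow> lin_ext \<phi> f = (\<Sum>m\<in>S. Poly_Mapping.lookup f m * \<phi> m)"
  unfolding lin_ext_def by (rule sum.mono_neutral_left) (auto simp: in_keys_iff)

lemma lin_ext_zero [simp]: "lin_ext \<phi> 0 = 0"
  by (simp add: lin_ext_def)

lemma lin_ext_single [simp]: "lin_ext \<phi> (Poly_Mapping.single m c) = c * \<phi> m"
  by (subst lin_ext_superset[of "{m}"]) (auto split: if_splits)

lemma lin_ext_add: "lin_ext \<phi> (f + g) = lin_ext \<phi> f + lin_ext \<phi> g"
proof -
  let ?S = "Poly_Mapping.keys f \<union> Poly_Mapping.keys g"
  have "lin_ext \<phi> (f + g) = (\<Sum>m\<in>?S. Poly_Mapping.lookup (f + g) m * \<phi> m)"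
    by (rule lin_ext_superset) (auto dest: set_mp[OF Poly_Mapping.keys_add])
  also have "\<dots> = lin_ext \<phi> f + lin_ext \<phi> g"
    unfolding lookup_add distrib_right sum.distrib
    by (subst (1 2) lin_ext_superset[of ?S]) auto
  finally show ?thesis .
qed

lemma lin_ext_diff: "lin_ext \<phi> (f - g) = lin_ext \<phi> f - lin_ext \<phi> g"
  using lin_ext_add[of \<phi> "f - g" g] by simp

lemma lin_ext_sum: "lin_ext \<phi> (sum f A) = (\<Sum>a\<in>A. lin_ext \<phi> (f a))"
  by (induction A rule: infinite_finite_induct) (simp_all add: lin_ext_add)

lemma lin_ext_mult:
  "lin_ext \<phi> (f * g) = (\<Sum>a\<in>Poly_Mapping.keys f. Poly_Mapping.lookup f a * lin_ext (\<lambda>b. \<phi> (a + b)) g)"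
proof -
  let ?F = "\<lambda>f. \<Sum>m\<in>Poly_Mapping.keys f. Poly_Mapping.single m (Poly_Mapping.lookup f m)"
  have "lin_ext \<phi> (f * g) = lin_ext \<phi> (?F f * ?F g)"
    by (simp only: mpoly_expansion[symmetric])
  also have "\<dots> = (\<Sum>a\<in>Poly_Mapping.keys f. \<Sum>b\<in>Poly_Mapping.keys g.
      Poly_Mapping.lookup f a * Poly_Mapping.lookup g b * \<phi> (a + b))"
    by (simp only: sum_product lin_ext_sum mult_single lin_ext_single)
  finally show ?thesis
    by (simp only: lin_ext_def sum_distrib_left mult.assoc)
qed

lemma lin_ext_indicator: "lin_ext (\<lambda>m. if m = \<tau> then 1 else 0) f = Poly_Mapping.lookup f \<tau>"
  by (subst lin_ext_superset[of "insert \<tau> (Poly_Mapping.keys f)"]) (auto simp: if_distrib cong: if_cong)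

section \<open>Exponent vectors, weighted degrees and binomials\<close>

definition exps :: "nat \<Rightarrow> (nat \<Rightarrow>\<^sub>0 nat) set" where
  "exps n = {m. Poly_Mapping.keys m \<subseteq> {1..n}}"

definition wdeg :: "nat \<Rightarrow> (nat \<Rightarrow> nat) \<Rightarrow> (nat \<Rightarrow>\<^sub>0 nat) \<Rightarrow> nat" where
  "wdeg n w m = (\<Sum>i=1..n. Poly_Mapping.lookup m i * w i)"

lemma zero_in_exps [simp]: "0 \<in> exps n"
  by (simp add: exps_def)

lemma add_in_exps_iff [simp]: "a + b \<in> exps n \<longleftrightarrow> a \<in> exps n \<and> b \<in> exps n"
proof -
  have "Poly_Mapping.keys (a + b) = Poly_Mapping.keys a \<union> Poly_Mapping.keys b"
    by (auto simp: in_keys_iff lookup_add)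
  then show ?thesis by (simp add: exps_def)
qed

lemma single_in_exps [simp]: "i \<in> {1..n} \<Longrightarrow> Poly_Mapping.single i c \<in> exps n"
  by (simp add: exps_def)

lemma sum_in_exps: "(\<And>i. i \<in> A \<Longrightarrow> f i \<in> exps n) \<Longrightarrow> sum f A \<in> exps n"
  by (induction A rule: infinite_finite_induct) auto

lemma exps_eqI: "a \<in> exps n \<Longrightarrow> b \<in> exps n \<Longrightarrow>
    (\<And>i. i \<in> {1..n} \<Longrightarrow> Poly_Mapping.lookup a i = Poly_Mapping.lookup b i) \<Longrightarrow> a = b"
  unfolding exps_def by (rule poly_mapping_eqI) (metis in_keys_iff mem_Collect_eq subsetD)

lemma wdeg_add: "wdeg n w (a + b) = wdeg n w a + wdeg n w b"
  by (simp add: wdeg_def lookup_add distrib_right sum.distrib)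

lemma wdeg_zero [simp]: "wdeg n w 0 = 0"
  by (simp add: wdeg_def)

lemma wdeg_single [simp]: "i \<in> {1..n} \<Longrightarrow> wdeg n w (Poly_Mapping.single i c) = c * w i"
  unfolding wdeg_def
  by (subst sum.mono_neutral_right[of _ "{i}"]) (auto simp: lookup_single when_def)

lemma carrier_mpoly_ring: "f \<in> carrier (mpoly_ring n) \<longleftrightarrow> Poly_Mapping.keys f \<subseteq> exps n"
  by (auto simp: exps_def)

lemma single_in_carrier: "m \<in> exps n \<Longrightarrow> Poly_Mapping.single m c \<in> carrier (mpoly_ring n)"
  unfolding carrier_mpoly_ring by auto

lemma prod_monom_power:
  "finite A \<Longrightarrow> (\<Prod>i\<in>A. (Polynomial.monom (1::'k::field) (w i)) ^ l i) = Polynomial.monom 1 (\<Sum>i\<in>A. l i * w i)"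
  by (induction A rule: finite_induct) (simp_all add: monom_power mult_monom mult.commute)

lemma toric_map_carrier:
  assumes "f \<in> carrier (mpoly_ring n)"
  shows "toric_map w f = (\<Sum>m\<in>Poly_Mapping.keys f. Polynomial.monom (Poly_Mapping.lookup f m) (wdeg n w m))"
  unfolding toric_map_def
proof (rule sum.cong[OF refl])
  fix m assume "m \<in> Poly_Mapping.keys f"
  then have m: "Poly_Mapping.keys m \<subseteq> {1..n}" using assms by simp
  have "(\<Sum>i\<in>Poly_Mapping.keys m. Poly_Mapping.lookup m i * w i) = wdeg n w m"
    unfolding wdeg_def by (rule sum.mono_neutral_left) (use m in \<open>auto simp: in_keys_iff\<close>)
  then show "[:Poly_Mapping.lookup f m:] * (\<Prod>i\<in>Poly_Mapping.keys m. Polynomial.monom 1 (w i) ^ Poly_Mapping.lookup m i)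
      = Polynomial.monom (Poly_Mapping.lookup f m) (wdeg n w m)"
    by (simp add: prod_monom_power smult_monom)
qed

text \<open>For each \<open>b\<close> the coefficients of \<open>f\<close> in degree
  \<open>b\<close> add up to the coefficient of \<open>t ^ b\<close> in its image, which is 0. Every
  functional that sees only the degree of a monomial therefore vanishes.\<close>

lemma lin_ext_toric_ideal:
  assumes "f \<in> toric_ideal n w"
  shows "lin_ext (\<lambda>m. \<psi> (wdeg n w m)) f = 0"
proof -
  have carr: "f \<in> carrier (mpoly_ring n)" and 0: "toric_map w f = 0"
    using assms unfolding toric_ideal_def by auto
  let ?K = "Poly_Mapping.keys f"
  have coeff: "(\<Sum>m\<in>{m\<in>?K. wdeg n w m = b}. Poly_Mapping.lookup f m) = 0" for b
  proof -
    have "0 = coeff (toric_map w f) b" using 0 by simp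
    also have "\<dots> = (\<Sum>m\<in>?K. if wdeg n w m = b then Poly_Mapping.lookup f m else 0)"
      unfolding toric_map_carrier[OF carr] by (simp add: coeff_sum coeff_monom)
    also have "\<dots> = (\<Sum>m\<in>{m\<in>?K. wdeg n w m = b}. Poly_Mapping.lookup f m)"
      by (simp add: sum.inter_filter)
    finally show ?thesis by simp
  qed
  have "lin_ext (\<lambda>m. \<psi> (wdeg n w m)) f
      = (\<Sum>b\<in>wdeg n w ` ?K. \<Sum>m\<in>{m\<in>?K. wdeg n w m = b}. Poly_Mapping.lookup f m * \<psi> (wdeg n w m))"
    unfolding lin_ext_def by (rule sum.image_gen) simp
  also have "\<dots> = (\<Sum>b\<in>wdeg n w ` ?K. (\<Sum>m\<in>{m\<in>?K. wdeg n w m = b}. Poly_Mapping.lookup f m) * \<psi> b)"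
    unfolding sum_distrib_right by (intro sum.cong) auto
  also have "\<dots> = 0" unfolding coeff by simp
  finally show ?thesis .
qed

lemma lin_ext_cong:
  "(\<And>m. m \<in> Poly_Mapping.keys f \<Longrightarrow> \<phi> m = \<psi> m) \<Longrightarrow> lin_ext \<phi> f = lin_ext \<psi> f"
  unfolding lin_ext_def by (rule sum.cong) auto

lemma binomial_in_toric_ideal:
  assumes "a \<in> exps n" "b \<in> exps n" "wdeg n w a = wdeg n w b"
  shows "Poly_Mapping.single a 1 - Poly_Mapping.single b (1::'k::field) \<in> toric_ideal n w"
proof -
  have carr: "Poly_Mapping.single a 1 - Poly_Mapping.single b (1::'k) \<in> carrier (mpoly_ring n)"
    unfolding carrier_mpoly_ring using assms
    by (auto simp: in_keys_iff lookup_minus lookup_single when_def split: if_splits)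
  have 1: "toric_map w (Poly_Mapping.single m (1::'k)) = Polynomial.monom 1 (wdeg n w m)" if "m \<in> exps n" for m
    using toric_map_carrier[OF single_in_carrier[OF that], of w 1] by (simp add: lookup_single)
  have "toric_map w (Poly_Mapping.single a 1 - Poly_Mapping.single b (1::'k)) + toric_map w (Poly_Mapping.single b 1)
      = toric_map w (Poly_Mapping.single a 1)"
    unfolding toric_map_add[symmetric] by simp
  then have "toric_map w (Poly_Mapping.single a 1 - Poly_Mapping.single b (1::'k)) = 0"
    unfolding 1[OF assms(1)] 1[OF assms(2)] assms(3) by simp
  then show ?thesis using carr unfolding toric_ideal_def by simp
qed

lemma toric_ideal_ideal: "ideal (toric_ideal n w :: 'k::field mpoly set) (mpoly_ring n)"
proof -
  interpret R: cring "mpoly_ring n :: 'k mpoly ring" by (rule mpoly_ring_cring)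
  have neg: "\<ominus>\<^bsub>mpoly_ring n\<^esub> f = - f" if "f \<in> carrier (mpoly_ring n)" for f :: "'k mpoly"
  proof (rule R.minus_equality)
    show "- f \<in> carrier (mpoly_ring n)" using that by (simp add: in_keys_iff)
  qed (use that in auto)
  have neg_map: "toric_map w (- f) = - toric_map w f" for f :: "'k mpoly"
    using toric_map_add[of w "- f" f] by (simp add: toric_map_zero eq_neg_iff_add_eq_0)
  show ?thesis
  proof (rule idealI)
    show "subgroup (toric_ideal n w :: 'k mpoly set) (add_monoid (mpoly_ring n))"
    proof (rule R.add.subgroupI)
      show "toric_ideal n w \<subseteq> carrier (mpoly_ring n :: 'k mpoly ring)"
        by (auto simp: toric_ideal_def)
      have "(0 :: 'k mpoly) \<in> toric_ideal n w" by (simp add: toric_ideal_def toric_map_zero)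
      then show "(toric_ideal n w :: 'k mpoly set) \<noteq> {}" by blast
      show "\<ominus>\<^bsub>mpoly_ring n\<^esub> f \<in> toric_ideal n w" if "f \<in> toric_ideal n w" for f :: "'k mpoly"
        using that neg[of f] neg_map[of f] R.a_inv_closed[of f] unfolding toric_ideal_def by simp
      show "f \<oplus>\<^bsub>mpoly_ring n\<^esub> g \<in> toric_ideal n w"
        if "f \<in> toric_ideal n w" "g \<in> toric_ideal n w" for f g :: "'k mpoly"
        using that R.a_closed[of f g] unfolding toric_ideal_def by (simp add: toric_map_add)
    qed
    show "x \<otimes>\<^bsub>mpoly_ring n\<^esub> f \<in> toric_ideal n w" "f \<otimes>\<^bsub>mpoly_ring n\<^esub> x \<in> toric_ideal n w"
      if "f \<in> toric_ideal n w" "x \<in> carrier (mpoly_ring n)" for f x :: "'k mpoly"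
      using that R.m_closed[of x f] R.m_closed[of f x] unfolding toric_ideal_def by (simp_all add: toric_map_mult)
  qed (rule R.ring_axioms)
qed

lemma toric_ideal_carrier: "toric_ideal n w \<subseteq> carrier (mpoly_ring n)"
  by (auto simp: toric_ideal_def)

text \<open>A toric ideal is spanned by its binomials: each monomial of \<open>f\<close> is compared
  with one chosen monomial of the same degree, and the chosen monomials cancel in total.\<close>

lemma toric_ideal_subset:
  fixes J :: "'k::field mpoly set"
  assumes "ideal J (mpoly_ring n)"
    and binomials: "\<And>a b. a \<in> exps n \<Longrightarrow> b \<in> exps n \<Longrightarrow> wdeg n w a = wdeg n w b \<Longrightarrow>
      Poly_Mapping.single a 1 - Poly_Mapping.single b 1 \<in> J"
  shows "toric_ideal n w \<subseteq> J"
proof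
  fix f :: "'k mpoly" assume f: "f \<in> toric_ideal n w"
  interpret J: ideal J "mpoly_ring n" by fact
  let ?K = "Poly_Mapping.keys f"
  have K: "?K \<subseteq> exps n" using f toric_ideal_carrier carrier_mpoly_ring by blast
  define r where "r b = (SOME a. a \<in> exps n \<and> wdeg n w a = b)" for b
  have r: "r (wdeg n w m) \<in> exps n \<and> wdeg n w (r (wdeg n w m)) = wdeg n w m" if "m \<in> exps n" for m
    unfolding r_def by (rule someI_ex) (use that in blast)
  have "(\<Sum>m\<in>?K. Poly_Mapping.single (r (wdeg n w m)) (Poly_Mapping.lookup f m)) = 0"
  proof (rule poly_mapping_eqI)
    fix \<tau>
    \<comment> \<open>The coefficient at \<open>\<tau>\<close> collects those terms of
      \<open>f\<close> whose degree is represented by \<open>\<tau>\<close>, a condition on the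
      degree alone.\<close>
    have "Poly_Mapping.lookup (\<Sum>m\<in>?K. Poly_Mapping.single (r (wdeg n w m)) (Poly_Mapping.lookup f m)) \<tau>
        = lin_ext (\<lambda>m. (\<lambda>b. if r b = \<tau> then 1 else 0) (wdeg n w m)) f"
      unfolding lin_ext_def lookup_sum by (rule sum.cong) (auto simp: lookup_single when_def)
    also have "\<dots> = 0" by (rule lin_ext_toric_ideal[OF f])
    finally show "Poly_Mapping.lookup (\<Sum>m\<in>?K. Poly_Mapping.single (r (wdeg n w m)) (Poly_Mapping.lookup f m)) \<tau>
        = Poly_Mapping.lookup 0 \<tau>" by simp
  qed
  then have "f = (\<Sum>m\<in>?K. Poly_Mapping.single m (Poly_Mapping.lookup f m))
      - (\<Sum>m\<in>?K. Poly_Mapping.single (r (wdeg n w m)) (Poly_Mapping.lookup f m))"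
    using mpoly_expansion[of f] by simp
  also have "\<dots> = (\<Sum>m\<in>?K. Poly_Mapping.single 0 (Poly_Mapping.lookup f m) *
      (Poly_Mapping.single m 1 - Poly_Mapping.single (r (wdeg n w m)) 1))"
    by (simp add: right_diff_distrib mult_single sum_subtractf)
  also have "\<dots> \<in> J"
  proof -
    have "(\<Sum>m\<in>A. Poly_Mapping.single 0 (Poly_Mapping.lookup f m) *
      (Poly_Mapping.single m 1 - Poly_Mapping.single (r (wdeg n w m)) 1)) \<in> J" if "finite A" "A \<subseteq> ?K" for A
      using that
    proof (induction A rule: finite_induct)
      case empty
      show ?case using additive_subgroup.zero_closed[OF J.is_additive_subgroup] by simp
    next
      case (insert m A)
      have m: "m \<in> exps n" using insert K by auto
      have "Poly_Mapping.single 0 (Poly_Mapping.lookup f m) *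
          (Poly_Mapping.single m 1 - Poly_Mapping.single (r (wdeg n w m)) 1) \<in> J"
        using J.I_l_closed[OF binomials[OF m, of "r (wdeg n w m)"]
            single_in_carrier[OF zero_in_exps, where c = "Poly_Mapping.lookup f m"]] r[OF m] by simp
      then show ?case using additive_subgroup.a_closed[OF J.is_additive_subgroup] insert by simp
    qed
    then show ?thesis by simp
  qed
  finally show "f \<in> J" .
qed

section \<open>The lower bound \<open>n - 1\<close>\<close>

lemma lin_ext_add_const:
  "lin_ext (\<lambda>m. c + \<phi> m) f = c * lin_ext (\<lambda>_. 1) f + lin_ext \<phi> f"
  by (simp add: lin_ext_def distrib_left sum.distrib sum_distrib_left mult.commute)

text \<open>
  The bound comes from the gradient at the point \<open>(1, \<dots>, 1)\<close>, where the curve is smooth in every characteristic.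
\<close>

lemma toric_generators_ge_height:
  fixes G :: "'k::field mpoly set"
  assumes pos: "\<And>i. i \<in> {1..n} \<Longrightarrow> w i > 0" and "n > 0"
    and G: "finite G" "G \<subseteq> carrier (mpoly_ring n)" "genideal (mpoly_ring n) G = toric_ideal n w"
  shows "n - 1 \<le> card G"
proof -
  define g where "g = Gcd (w ` {1..n})"
  have g_dvd: "g dvd w i" if "i \<in> {1..n}" for i
    unfolding g_def using that by (intro Gcd_dvd) auto
  \<comment> \<open>Divided by \<open>g\<close>, the weights have gcd 1, so the characteristic
    cannot divide all of them.\<close>
  have "\<exists>j\<in>{1..n}. of_nat (w j div g) \<noteq> (0::'k)"
  proof (rule ccontr)
    assume "\<not> ?thesis"
    then have *: "CHAR('k) dvd w i div g" if "i \<in> {1..n}" for i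
      using that by (auto simp: of_nat_eq_0_iff_char_dvd)
    have "CHAR('k) * g dvd w i" if "i \<in> {1..n}" for i
      using mult_dvd_mono[OF *[OF that] dvd_refl[of g]] g_dvd[OF that] by simp
    then have "CHAR('k) * g dvd g"
      unfolding g_def by (intro Gcd_greatest) auto
    moreover have "g > 0" using g_dvd[of 1] pos[of 1] \<open>n > 0\<close> by (auto intro: Nat.gr0I)
    ultimately have "CHAR('k) = 1" by (simp add: dvd_mult_cancel2)
    then show False by simp
  qed
  then obtain j where j: "j \<in> {1..n}" "of_nat (w j div g) \<noteq> (0::'k)" by blast
  define \<Lambda> where "\<Lambda> f = (\<lambda>i. lin_ext (\<lambda>m. of_nat (Poly_Mapping.lookup m i)) f)" for f :: "'k mpoly"
  have sum0: "lin_ext (\<lambda>_. 1) f = 0" if "f \<in> toric_ideal n w" for f :: "'k mpoly"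
    using lin_ext_toric_ideal[OF that, of "\<lambda>_. 1"] .
  \<comment> \<open>This is the Leibniz rule at the all-ones point, where
    \<open>lin_ext (\<lambda>_. 1)\<close> is evaluation: the term with the gradient of
    \<open>r\<close> drops out because \<open>f\<close> vanishes there.\<close>
  have left: "\<Lambda> (r * f) = (\<lambda>i. lin_ext (\<lambda>_. 1) r * \<Lambda> f i)" if "f \<in> toric_ideal n w" for f r :: "'k mpoly"
    unfolding \<Lambda>_def lin_ext_mult lookup_add of_nat_add lin_ext_add_const sum0[OF that]
    by (simp add: lin_ext_def[of "\<lambda>_. 1"] sum_distrib_right)
  \<comment> \<open>With coordinate \<open>j\<close> left out, the gradient of the binomial in
    \<open>x_i\<close> and \<open>x_j\<close> is a nonzero multiple of the \<open>i\<close>-th unit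
    vector, thanks to the choice of \<open>j\<close>.\<close>
  have "card ({1..n} - {j}) \<le> card G"
  proof (rule card_generators_ge[where \<Lambda> = \<Lambda> and \<epsilon> = "lin_ext (\<lambda>_. 1)"])
    show "ring (mpoly_ring n :: 'k mpoly ring)" using mpoly_ring_cring by (rule cring.axioms)
    fix i assume i: "i \<in> {1..n} - {j}"
    let ?f = "Poly_Mapping.single (Poly_Mapping.single i (w j div g)) 1 - Poly_Mapping.single (Poly_Mapping.single j (w i div g)) (1::'k)"
    have "(w j div g) * w i = (w i div g) * w j"
      using g_dvd[of i] g_dvd[OF j(1)] i by (metis DiffD1 div_mult_swap mult.commute)
    then have "?f \<in> toric_ideal n w" using i j by (intro binomial_in_toric_ideal) auto
    moreover have "\<Lambda> ?f s = (if s = i then of_nat (w j div g) else 0)" if "s \<in> {1..n} - {j}" for s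
      using that i by (auto simp: \<Lambda>_def lin_ext_diff lookup_single when_def)
    ultimately show "\<exists>f\<in>genideal (mpoly_ring n) G. \<Lambda> f i \<noteq> 0 \<and> (\<forall>s\<in>{1..n} - {j} - {i}. \<Lambda> f s = 0)"
      unfolding G(3) using i j by (intro bexI[of _ ?f]) auto
  qed (use G left in \<open>auto simp: \<Lambda>_def lin_ext_add mult.commute\<close>)
  then show ?thesis using j by simp
qed

text \<open>In the graph on the monomials of one degree whose edges join monomials with a common
  variable, \<open>\<tau>\<close> is an isolated vertex.\<close>

definition isolated :: "nat \<Rightarrow> (nat \<Rightarrow> nat) \<Rightarrow> (nat \<Rightarrow>\<^sub>0 nat) \<Rightarrow> bool" where
  "isolated n w \<tau> \<longleftrightarrow> (\<forall>u\<in>exps n. wdeg n w u = wdeg n w \<tau> \<and> u \<noteq> \<tau> \<longrightarrow>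
     Poly_Mapping.keys u \<inter> Poly_Mapping.keys \<tau> = {})"

text \<open>A term of \<open>r\<close> with exponent \<open>a\<close> other than 0 contributes
  nothing: if \<open>a + b0 = \<tau>\<close> and \<open>b\<close> has the degree of
  \<open>b0\<close>, then \<open>a + b\<close> shares a variable with \<open>\<tau>\<close> and so
  equals it. The contributing \<open>b\<close> in \<open>f\<close> are thus selected by degree
  alone, and their coefficients sum to 0.\<close>

lemma lookup_mult_isolated:
  fixes f r :: "'k::field mpoly"
  assumes f: "f \<in> toric_ideal n w" and r: "r \<in> carrier (mpoly_ring n)"
    and \<tau>: "\<tau> \<in> exps n" "isolated n w \<tau>"
  shows "Poly_Mapping.lookup (r * f) \<tau> = Poly_Mapping.lookup r 0 * Poly_Mapping.lookup f \<tau>"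
proof -
  have f_exps: "m \<in> exps n" if "m \<in> Poly_Mapping.keys f" for m
    using f toric_ideal_carrier carrier_mpoly_ring that by blast
  have 0: "lin_ext (\<lambda>b. if a + b = \<tau> then 1 else 0) f = 0" if a: "a \<in> Poly_Mapping.keys r" "a \<noteq> 0" for a
  proof (cases "\<exists>b0\<in>exps n. a + b0 = \<tau>")
    case True
    then obtain b0 where b0: "a + b0 = \<tau>" by blast
    have aexps: "a \<in> exps n" using r a carrier_mpoly_ring by blast
    have "(a + b = \<tau>) = (wdeg n w b = wdeg n w b0)" if b: "b \<in> Poly_Mapping.keys f" for b
    proof
      assume "a + b = \<tau>"
      then show "wdeg n w b = wdeg n w b0" using b0 by (metis add_left_imp_eq)
    next
      assume "wdeg n w b = wdeg n w b0"
      then have "wdeg n w (a + b) = wdeg n w \<tau>" unfolding b0[symmetric] wdeg_add by simp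
      moreover have "Poly_Mapping.keys (a + b) \<inter> Poly_Mapping.keys \<tau> \<noteq> {}"
      proof -
        obtain i where "Poly_Mapping.lookup a i \<noteq> 0" using a(2) by (metis lookup_zero poly_mapping_eqI)
        then show ?thesis unfolding b0[symmetric] by (auto simp: in_keys_iff lookup_add)
      qed
      ultimately show "a + b = \<tau>"
        using \<tau>(2) aexps f_exps[OF b] unfolding isolated_def by (meson add_in_exps_iff)
    qed
    then have "lin_ext (\<lambda>b. if a + b = \<tau> then 1 else 0) f
        = lin_ext (\<lambda>b. (\<lambda>c. if c = wdeg n w b0 then 1 else 0) (wdeg n w b)) f"
      by (intro lin_ext_cong) auto
    then show ?thesis
      using lin_ext_toric_ideal[OF f, of "\<lambda>c. if c = wdeg n w b0 then 1 else 0"] by simp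
  next
    case False
    then have "lin_ext (\<lambda>b. if a + b = \<tau> then 1 else 0) f = lin_ext (\<lambda>_. 0) f"
      using f_exps by (intro lin_ext_cong) auto
    then show ?thesis by (simp add: lin_ext_def)
  qed
  have "Poly_Mapping.lookup (r * f) \<tau> = lin_ext (\<lambda>m. if m = \<tau> then 1 else 0) (r * f)"
    by (simp add: lin_ext_indicator)
  also have "\<dots> = (\<Sum>a\<in>insert 0 (Poly_Mapping.keys r). Poly_Mapping.lookup r a * lin_ext (\<lambda>b. if a + b = \<tau> then 1 else 0) f)"
    unfolding lin_ext_mult by (rule sum.mono_neutral_left) (auto simp: in_keys_iff)
  also have "\<dots> = (\<Sum>a\<in>{0}. Poly_Mapping.lookup r a * lin_ext (\<lambda>b. if a + b = \<tau> then 1 else 0) f)"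
    by (rule sum.mono_neutral_right) (auto simp: 0)
  finally show ?thesis by (simp add: lin_ext_indicator)
qed

text \<open>Reading coefficients at \<open>T\<close> fits \<open>card_generators_ge\<close>, with
  the constant term as \<open>\<epsilon>\<close>. As \<open>u\<close> lies outside \<open>T\<close>,
  the binomial of \<open>\<tau>\<close> and \<open>u\<close> maps to a unit vector.\<close>

lemma toric_generators_ge_isolated:
  fixes G :: "'k::field mpoly set"
  assumes T: "finite T" "T \<subseteq> exps n" "\<And>\<tau>. \<tau> \<in> T \<Longrightarrow> isolated n w \<tau>"
    and other: "\<And>\<tau>. \<tau> \<in> T \<Longrightarrow> \<exists>u\<in>exps n - T. wdeg n w u = wdeg n w \<tau>"
    and G: "finite G" "G \<subseteq> carrier (mpoly_ring n)" "genideal (mpoly_ring n) G = toric_ideal n w"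
  shows "card T \<le> card G"
proof -
  define \<Lambda> where "\<Lambda> f = (\<lambda>\<tau>. if \<tau> \<in> T then Poly_Mapping.lookup f \<tau> else 0)" for f :: "'k mpoly"
  have left: "\<Lambda> (r * f) = (\<lambda>\<tau>. Poly_Mapping.lookup r 0 * \<Lambda> f \<tau>)"
    if "f \<in> toric_ideal n w" "r \<in> carrier (mpoly_ring n)" for f r :: "'k mpoly"
    using lookup_mult_isolated[OF that] T unfolding \<Lambda>_def by (auto simp: fun_eq_iff)
  show ?thesis
  proof (rule card_generators_ge[where \<Lambda> = \<Lambda> and \<epsilon> = "\<lambda>f. Poly_Mapping.lookup f 0"])
    show "ring (mpoly_ring n :: 'k mpoly ring)" using mpoly_ring_cring by (rule cring.axioms)
    fix \<tau> assume \<tau>: "\<tau> \<in> T"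
    then obtain u where u: "u \<in> exps n" "u \<notin> T" "wdeg n w u = wdeg n w \<tau>" using other by blast
    let ?f = "Poly_Mapping.single \<tau> 1 - Poly_Mapping.single u (1::'k)"
    have "?f \<in> toric_ideal n w" using u \<tau> T(2) by (intro binomial_in_toric_ideal) auto
    moreover have "\<Lambda> ?f s = (if s = \<tau> then 1 else 0)" if "s \<in> T" for s
      using that u \<tau> by (auto simp: \<Lambda>_def lookup_minus lookup_single when_def)
    ultimately show "\<exists>f\<in>genideal (mpoly_ring n) G. \<Lambda> f \<tau> \<noteq> 0 \<and> (\<forall>s\<in>T - {\<tau>}. \<Lambda> f s = 0)"
      unfolding G(3) using \<tau> by (intro bexI[of _ ?f]) auto
  next
    show "\<Lambda> (r \<otimes>\<^bsub>mpoly_ring n\<^esub> f) = (\<lambda>t. Poly_Mapping.lookup r 0 * \<Lambda> f t)"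
      "\<Lambda> (f \<otimes>\<^bsub>mpoly_ring n\<^esub> r) = (\<lambda>t. Poly_Mapping.lookup r 0 * \<Lambda> f t)"
      if "f \<in> genideal (mpoly_ring n) G" "r \<in> carrier (mpoly_ring n)" for f r :: "'k mpoly"
      using left[of f r] that G(3) by (simp_all add: mult.commute)
  qed (use G T in \<open>auto simp: \<Lambda>_def lookup_add\<close>)
qed

text \<open>The gradient bound supplies the lower estimate, so \<open>n - 1\<close> generators that
  capture all homogeneous binomials suffice.\<close>

lemma toric_complete_intersectionI:
  fixes G :: "'k::field mpoly set"
  assumes pos: "\<And>i. i \<in> {1..n} \<Longrightarrow> w i > 0" and "n > 0"
    and G: "finite G" "card G \<le> n - 1" "G \<subseteq> toric_ideal n w"
    and binomials: "\<And>a b. a \<in> exps n \<Longrightarrow> b \<in> exps n \<Longrightarrow> wdeg n w a = wdeg n w b \<Longrightarrow>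
      Poly_Mapping.single a 1 - Poly_Mapping.single b 1 \<in> genideal (mpoly_ring n) G"
  shows "toric_complete_intersection TYPE('k) n w"
proof -
  let ?\<mu> = "INF G \<in> {G. finite G \<and> G \<subseteq> carrier (mpoly_ring n) \<and>
      genideal (mpoly_ring n) G = (toric_ideal n w :: 'k mpoly set)}. enat (card G)"
  interpret R: cring "mpoly_ring n :: 'k mpoly ring" by (rule mpoly_ring_cring)
  have Gc: "G \<subseteq> carrier (mpoly_ring n)" using G(3) toric_ideal_carrier by blast
  have eq: "genideal (mpoly_ring n) G = toric_ideal n w"
    using R.genideal_minimal[OF toric_ideal_ideal G(3)]
      toric_ideal_subset[OF R.genideal_ideal[OF Gc] binomials] by blast
  show ?thesis
    unfolding toric_complete_intersection_def min_num_generators_def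
  proof (rule antisym)
    have "?\<mu> \<le> enat (card G)"
      by (rule INF_lower) (use G Gc eq in auto)
    also have "\<dots> \<le> enat (n - 1)" using G(2) by simp
    finally show "?\<mu> \<le> enat (n - 1)" .
    show "enat (n - 1) \<le> ?\<mu>"
      by (rule INF_greatest) (use toric_generators_ge_height[OF pos \<open>n > 0\<close>] in auto)
  qed
qed

lemma not_toric_complete_intersectionI:
  assumes "n > 0"
    and T: "finite T" "T \<subseteq> exps n" "\<And>\<tau>. \<tau> \<in> T \<Longrightarrow> isolated n w \<tau>"
    and other: "\<And>\<tau>. \<tau> \<in> T \<Longrightarrow> \<exists>u\<in>exps n - T. wdeg n w u = wdeg n w \<tau>"
    and "card T = n"
  shows "\<not> toric_complete_intersection TYPE('k::field) n w"
proof -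
  let ?\<mu> = "INF G \<in> {G. finite G \<and> G \<subseteq> carrier (mpoly_ring n) \<and>
      genideal (mpoly_ring n) G = (toric_ideal n w :: 'k mpoly set)}. enat (card G)"
  have "enat n \<le> ?\<mu>"
    by (rule INF_greatest) (use toric_generators_ge_isolated[OF T other] \<open>card T = n\<close> in auto)
  moreover have "enat (n - 1) < enat n" using \<open>n > 0\<close> by simp
  ultimately show ?thesis
    unfolding toric_complete_intersection_def min_num_generators_def by (metis leD)
qed

section \<open>Congruence of monomials modulo an ideal\<close>

definition binom_rel :: "'k::field mpoly set \<Rightarrow> (nat \<Rightarrow>\<^sub>0 nat) \<Rightarrow> (nat \<Rightarrow>\<^sub>0 nat) \<Rightarrow> bool" where
  "binom_rel J a b \<longleftrightarrow> Poly_Mapping.single a 1 - Poly_Mapping.single b 1 \<in> J"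

context
  fixes n :: nat and J :: "'k::field mpoly set"
  assumes J: "ideal J (mpoly_ring n)"
begin

lemma binom_rel_refl: "binom_rel J a a"
  using additive_subgroup.zero_closed[OF ideal.axioms(1)[OF J]] by (simp add: binom_rel_def)

lemma binom_rel_trans:
  assumes "binom_rel J a b" "binom_rel J b c"
  shows "binom_rel J a c"
  using additive_subgroup.a_closed[OF ideal.axioms(1)[OF J] assms[unfolded binom_rel_def]]
  by (simp add: binom_rel_def)

lemma binom_rel_sym:
  assumes "binom_rel J a b"
  shows "binom_rel J b a"
proof -
  have "Poly_Mapping.single 0 (-1) * (Poly_Mapping.single a 1 - Poly_Mapping.single b 1) \<in> J"
    using ideal.I_l_closed[OF J assms[unfolded binom_rel_def] single_in_carrier[OF zero_in_exps]] by simp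
  then show ?thesis by (simp add: binom_rel_def right_diff_distrib mult_single single_uminus)
qed

lemma binom_rel_shift:
  assumes "binom_rel J a b" "c \<in> exps n"
  shows "binom_rel J (c + a) (c + b)"
proof -
  have "Poly_Mapping.single c 1 * (Poly_Mapping.single a 1 - Poly_Mapping.single b 1) \<in> J"
    using ideal.I_l_closed[OF J assms(1)[unfolded binom_rel_def] single_in_carrier[OF assms(2)]] by simp
  then show ?thesis by (simp add: binom_rel_def right_diff_distrib mult_single)
qed

lemma binom_rel_add:
  assumes "binom_rel J a b" "binom_rel J c d" "b \<in> exps n" "c \<in> exps n"
  shows "binom_rel J (a + c) (b + d)"
  using binom_rel_trans[of "a + c" "b + c" "b + d"]
    binom_rel_shift[OF assms(1,4)] binom_rel_shift[OF assms(2,3)] by (simp add: add.commute)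


text \<open>After division by the gcd the two weights are coprime. Two monomials of equal degree in
  \<open>x_i\<close> and \<open>x_j\<close> then differ by a multiple of the single relation
  \<open>rel\<close>.\<close>

lemma binom_rel_two_variables:
  assumes ij: "i \<in> {1..n}" "j \<in> {1..n}" and pos: "w i > 0" "w j > 0"
    and rel: "binom_rel J (Poly_Mapping.single i (w j div gcd (w i) (w j))) (Poly_Mapping.single j (w i div gcd (w i) (w j)))"
    and eq: "c * w i + d * w j = c' * w i + d' * w j"
  shows "binom_rel J (Poly_Mapping.single i c + Poly_Mapping.single j d) (Poly_Mapping.single i c' + Poly_Mapping.single j d')"
proof -
  define g where "g = gcd (w i) (w j)"
  define x y where "x = w j div g" and "y = w i div g"
  have g: "w i = g * y" "w j = g * x" "g > 0" unfolding x_def y_def g_def using pos by auto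
  have cop: "coprime x y" unfolding x_def y_def g_def using pos by (simp add: div_gcd_coprime coprime_commute)
  have multiple: "binom_rel J (Poly_Mapping.single i (k * x)) (Poly_Mapping.single j (k * y))" for k
  proof (induction k)
    case 0
    then show ?case by (simp add: binom_rel_refl)
  next
    case (Suc k)
    have "binom_rel J (Poly_Mapping.single i (k * x) + Poly_Mapping.single i x) (Poly_Mapping.single j (k * y) + Poly_Mapping.single j y)"
      by (rule binom_rel_add[OF Suc]) (use rel ij in \<open>auto simp: x_def y_def g_def\<close>)
    then show ?case by (simp add: single_add[symmetric] add.commute)
  qed
  have main: "binom_rel J (Poly_Mapping.single i c' + Poly_Mapping.single j d') (Poly_Mapping.single i c + Poly_Mapping.single j d)"
    if le: "c \<le> c'" and eq: "c * w i + d * w j = c' * w i + d' * w j" for c d c' d'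
  proof -
    obtain e where e: "c' = c + e" using le le_Suc_ex by blast
    have "g * (d * x) = g * (e * y + d' * x)" using eq unfolding e g by (simp add: algebra_simps)
    then have dx: "d * x = e * y + d' * x" using g(3) by simp
    have "x > 0" using pos(2) g(2) by (auto intro: Nat.gr0I)
    have "x dvd e * y" using dx by (metis dvd_add_left_iff dvd_triv_right)
    then have "x dvd e" using cop by (simp add: coprime_dvd_mult_left_iff)
    then obtain k where k: "e = k * x" by (metis dvdE mult.commute)
    have "d = k * y + d'" using dx \<open>x > 0\<close> unfolding k
      by (metis (no_types, lifting) distrib_right mult.assoc mult.commute mult_right_cancel not_gr_zero)
    moreover have "binom_rel J ((Poly_Mapping.single i c + Poly_Mapping.single j d') + Poly_Mapping.single i (k * x))
        ((Poly_Mapping.single i c + Poly_Mapping.single j d') + Poly_Mapping.single j (k * y))"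
      by (rule binom_rel_shift[OF multiple]) (use ij in simp)
    ultimately show ?thesis unfolding e k by (simp add: single_add add.commute add.left_commute)
  qed
  show ?thesis
    using main[of c c' d d'] main[of c' c d' d] eq binom_rel_sym by (metis nat_le_linear)
qed

end

section \<open>Explicit generating sets\<close>

lemma sum_singles:
  assumes "m \<in> exps n"
  shows "m = (\<Sum>i=1..n. Poly_Mapping.single i (Poly_Mapping.lookup m i))"
proof (rule exps_eqI[OF assms sum_in_exps])
  fix i assume "i \<in> {1..n}"
  then show "Poly_Mapping.lookup m i = Poly_Mapping.lookup (\<Sum>i=1..n. Poly_Mapping.single i (Poly_Mapping.lookup m i)) i"
    by (simp add: lookup_sum lookup_single when_def)
qed simp

text \<open>One generator eliminates each variable from the third on, and one more relates the first
  two variables: \<open>n - 1\<close> in all.\<close>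

lemma toric_complete_intersection_two_generators:
  assumes pos: "\<And>i. i \<in> {1..n} \<Longrightarrow> w i > 0" and "n \<ge> 2"
    and combination: "\<And>i. i \<in> {3..n} \<Longrightarrow> \<exists>s t. w i = s * w 1 + t * w 2"
  shows "toric_complete_intersection TYPE('k::field) n w"
proof -
  interpret R: cring "mpoly_ring n :: 'k mpoly ring" by (rule mpoly_ring_cring)
  obtain s t where st: "w i = s i * w 1 + t i * w 2" if "i \<in> {3..n}" for i
    using combination by metis
  define N where "N a b = Poly_Mapping.single (1::nat) a + Poly_Mapping.single 2 b" for a b :: nat
  define g where "g = gcd (w 1) (w 2)"
  define G :: "'k mpoly set" where
    "G = insert (Poly_Mapping.single (Poly_Mapping.single 1 (w 2 div g)) 1 - Poly_Mapping.single (Poly_Mapping.single 2 (w 1 div g)) 1)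
      ((\<lambda>i. Poly_Mapping.single (Poly_Mapping.single i 1) 1 - Poly_Mapping.single (N (s i) (t i)) 1) ` {3..n})"
  have n12: "1 \<in> {1..n}" "2 \<in> {1..n}" using \<open>n \<ge> 2\<close> by auto
  have N_exps: "N a b \<in> exps n" for a b unfolding N_def using n12 by simp
  have N_deg: "wdeg n w (N a b) = a * w 1 + b * w 2" for a b unfolding N_def wdeg_add using n12 by simp
  have N_add: "N a b + N a' b' = N (a + a') (b + b')" for a b a' b'
    unfolding N_def by (simp add: single_add ac_simps)
  have G_sub: "G \<subseteq> toric_ideal n w"
  proof -
    have "(w 2 div g) * w 1 = (w 1 div g) * w 2"
      unfolding g_def by (metis div_mult_swap gcd_dvd1 gcd_dvd2 mult.commute)
    then show ?thesis unfolding G_def using n12 N_exps st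
      by (auto intro!: binomial_in_toric_ideal simp: N_deg)
  qed
  define J where "J = genideal (mpoly_ring n) G"
  have Gc: "G \<subseteq> carrier (mpoly_ring n)" using G_sub toric_ideal_carrier by blast
  have J: "ideal J (mpoly_ring n)" unfolding J_def by (rule R.genideal_ideal[OF Gc])
  have GJ: "G \<subseteq> J" unfolding J_def by (rule R.genideal_self[OF Gc])
  \<comment> \<open>\<open>P\<close> says that a monomial reduces to a normal form in the first two
    variables of the same degree; it is multiplicative and holds for each variable.\<close>
  define P where "P m \<longleftrightarrow> m \<in> exps n \<and> (\<exists>a b. binom_rel J m (N a b) \<and> wdeg n w m = a * w 1 + b * w 2)" for m
  have P_add: "P (m + m')" if PP: "P m" "P m'" for m m'
  proof -
    obtain a b a' b' where "binom_rel J m (N a b)" "wdeg n w m = a * w 1 + b * w 2"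
      "binom_rel J m' (N a' b')" "wdeg n w m' = a' * w 1 + b' * w 2"
      using PP unfolding P_def by blast
    then have "binom_rel J (m + m') (N (a + a') (b + b'))" "wdeg n w (m + m') = (a + a') * w 1 + (b + b') * w 2"
      using binom_rel_add[OF J, of m "N a b" m' "N a' b'"] N_exps PP
      unfolding P_def N_add wdeg_add by (auto simp: algebra_simps)
    then show ?thesis using PP unfolding P_def by auto
  qed
  have P_N: "P (N a b)" for a b
    unfolding P_def using N_exps N_deg binom_rel_refl[OF J] by blast
  have P_var: "P (Poly_Mapping.single i 1)" if i: "i \<in> {1..n}" for i
  proof -
    consider "i = 1" | "i = 2" | "i \<in> {3..n}" using i by fastforce
    then show ?thesis
    proof cases
      case 3
      then have "binom_rel J (Poly_Mapping.single i 1) (N (s i) (t i))"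
        using GJ unfolding binom_rel_def G_def by blast
      then show ?thesis unfolding P_def using st[OF 3] i by auto
    qed (use P_N[of 1 0] P_N[of 0 1] in \<open>simp_all add: N_def\<close>)
  qed
  have P_zero: "P 0" using P_N[of 0 0] by (simp add: N_def)
  have P_single: "P (Poly_Mapping.single i c)" if "i \<in> {1..n}" for i c
  proof (induction c)
    case (Suc c)
    from P_add[OF P_var[OF that] this] show ?case by (simp add: single_add[symmetric])
  qed (simp add: P_zero)
  have P: "P m" if "m \<in> exps n" for m
  proof -
    have "P (\<Sum>i\<in>A. Poly_Mapping.single i (Poly_Mapping.lookup m i))" if "finite A" "A \<subseteq> {1..n}" for A
      using that
    proof (induction A rule: finite_induct)
      case (insert i A)
      then have "P (Poly_Mapping.single i (Poly_Mapping.lookup m i) + (\<Sum>i\<in>A. Poly_Mapping.single i (Poly_Mapping.lookup m i)))"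
        by (intro P_add P_single) auto
      then show ?case using insert by simp
    qed (simp add: P_zero)
    from this[of "{1..n}"] show ?thesis using sum_singles[OF that] by simp
  qed
  show ?thesis
  proof (rule toric_complete_intersectionI[OF pos _ _ _ G_sub])
    show "finite G" unfolding G_def by simp
    have "card G \<le> Suc (card ((\<lambda>i. Poly_Mapping.single (Poly_Mapping.single i 1) (1::'k) - Poly_Mapping.single (N (s i) (t i)) 1) ` {3..n}))"
      unfolding G_def by (rule card_insert_le_m1) simp_all
    also have "\<dots> \<le> Suc (card {3..n})" using card_image_le[of "{3..n}"] by simp
    finally show "card G \<le> n - 1" using \<open>n \<ge> 2\<close> by simp
    show "n > 0" using \<open>n \<ge> 2\<close> by simp
    fix m m' assume m: "m \<in> exps n" "m' \<in> exps n" "wdeg n w m = wdeg n w m'"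
    obtain a b where ab: "binom_rel J m (N a b)" "wdeg n w m = a * w 1 + b * w 2"
      using P[OF m(1)] unfolding P_def by blast
    obtain a' b' where ab': "binom_rel J m' (N a' b')" "wdeg n w m' = a' * w 1 + b' * w 2"
      using P[OF m(2)] unfolding P_def by blast
    have "binom_rel J (N a b) (N a' b')" unfolding N_def
    proof (rule binom_rel_two_variables[OF J n12 pos[OF n12(1)] pos[OF n12(2)]])
      show "binom_rel J (Poly_Mapping.single 1 (w 2 div gcd (w 1) (w 2))) (Poly_Mapping.single 2 (w 1 div gcd (w 1) (w 2)))"
        using GJ unfolding binom_rel_def G_def g_def by blast
    qed (use ab ab' m in simp)
    then have "binom_rel J m m'"
      using binom_rel_trans[OF J] binom_rel_sym[OF J] ab(1) ab'(1) by blast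
    then show "Poly_Mapping.single m 1 - Poly_Mapping.single m' 1 \<in> genideal (mpoly_ring n) G"
      unfolding binom_rel_def J_def .
  qed
qed

text \<open>The semigroup is glued from \<open>w 2\<close> and the pair \<open>w 1\<close>,
  \<open>w 3\<close>. The assumption on \<open>l\<close> makes it the least positive number for
  which \<open>l * w 2\<close> is a multiple of \<open>gcd (w 1) (w 3)\<close>, so excess powers of
  \<open>x_2\<close> come in blocks of \<open>l\<close>, which the relation replaces.\<close>

lemma toric_complete_intersection_gluing:
  assumes pos: "\<And>i. i \<in> {1..3} \<Longrightarrow> w i > 0"
    and combination: "l * w 2 = s * w 1 + t * w 3"
    and l: "l * gcd (gcd (w 1) (w 3)) (w 2) = gcd (w 1) (w 3)"
  shows "toric_complete_intersection TYPE('k::field) 3 w"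
proof -
  interpret R: cring "mpoly_ring 3 :: 'k mpoly ring" by (rule mpoly_ring_cring)
  define N where "N a b c = Poly_Mapping.single (2::nat) b + (Poly_Mapping.single 1 a + Poly_Mapping.single 3 c)" for a b c :: nat
  define g where "g = gcd (w 1) (w 3)"
  define G :: "'k mpoly set" where
    "G = {Poly_Mapping.single (Poly_Mapping.single 1 (w 3 div g)) 1 - Poly_Mapping.single (Poly_Mapping.single 3 (w 1 div g)) 1,
      Poly_Mapping.single (Poly_Mapping.single 2 l) 1 - Poly_Mapping.single (N s 0 t) 1}"
  have n123: "1 \<in> {1..3::nat}" "2 \<in> {1..3::nat}" "3 \<in> {1..3::nat}" by auto
  have N_exps: "N a b c \<in> exps 3" for a b c unfolding N_def using n123 by simp
  have N_deg: "wdeg 3 w (N a b c) = a * w 1 + b * w 2 + c * w 3" for a b c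
    unfolding N_def wdeg_add using n123 by simp
  have G_sub: "G \<subseteq> toric_ideal 3 w"
  proof -
    have "(w 3 div g) * w 1 = (w 1 div g) * w 3"
      unfolding g_def by (metis div_mult_swap gcd_dvd1 gcd_dvd2 mult.commute)
    then show ?thesis unfolding G_def using n123 N_exps combination
      by (auto intro!: binomial_in_toric_ideal simp: N_deg)
  qed
  define J where "J = genideal (mpoly_ring 3) G"
  have Gc: "G \<subseteq> carrier (mpoly_ring 3)" using G_sub toric_ideal_carrier by blast
  have J: "ideal J (mpoly_ring 3)" unfolding J_def by (rule R.genideal_ideal[OF Gc])
  have GJ: "G \<subseteq> J" unfolding J_def by (rule R.genideal_self[OF Gc])
  have two: "binom_rel J (Poly_Mapping.single 1 a + Poly_Mapping.single 3 c) (Poly_Mapping.single 1 a' + Poly_Mapping.single 3 c')"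
    if "a * w 1 + c * w 3 = a' * w 1 + c' * w 3" for a c a' c'
  proof (rule binom_rel_two_variables[OF J n123(1,3) pos[OF n123(1)] pos[OF n123(3)] _ that])
    show "binom_rel J (Poly_Mapping.single 1 (w 3 div gcd (w 1) (w 3))) (Poly_Mapping.single 3 (w 1 div gcd (w 1) (w 3)))"
      using GJ unfolding binom_rel_def G_def g_def by blast
  qed
  have step: "binom_rel J (Poly_Mapping.single 2 (k * l)) (Poly_Mapping.single 1 (k * s) + Poly_Mapping.single 3 (k * t))" for k
  proof (induction k)
    case 0
    then show ?case by (simp add: binom_rel_refl[OF J])
  next
    case (Suc k)
    have 1: "binom_rel J (Poly_Mapping.single 2 l) (Poly_Mapping.single 1 s + Poly_Mapping.single 3 t)"
      using GJ unfolding binom_rel_def G_def N_def by simp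
    have "binom_rel J (Poly_Mapping.single 2 (k * l) + Poly_Mapping.single 2 l)
       ((Poly_Mapping.single 1 (k * s) + Poly_Mapping.single 3 (k * t)) + (Poly_Mapping.single 1 s + Poly_Mapping.single 3 t))"
      by (rule binom_rel_add[OF J Suc 1]) (use n123 in simp_all)
    then show ?case by (simp add: single_add ac_simps)
  qed
  have main: "binom_rel J (N a b c) (N a' b' c')"
    if le: "b' \<le> b" and eq: "a * w 1 + b * w 2 + c * w 3 = a' * w 1 + b' * w 2 + c' * w 3" for a b c a' b' c'
  proof -
    obtain e where e: "b = b' + e" using le le_Suc_ex by blast
    have eq': "e * w 2 + (a * w 1 + c * w 3) = a' * w 1 + c' * w 3" using eq unfolding e by (simp add: algebra_simps)
    have "g dvd a * w 1 + c * w 3" "g dvd a' * w 1 + c' * w 3" unfolding g_def by auto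
    \<comment> \<open>Dividing by the common gcd \<open>h\<close> turns this divisibility into
      \<open>l dvd e\<close>.\<close>
    then have "g dvd e * w 2" unfolding eq'[symmetric] by (metis dvd_add_left_iff)
    moreover define h where "h = gcd g (w 2)"
    have "h > 0" unfolding h_def using pos[OF n123(2)] by simp
    have "coprime (g div h) (w 2 div h)" unfolding h_def using pos[OF n123(2)] by (intro div_gcd_coprime) simp
    moreover have "g div h = l" using l \<open>h > 0\<close> unfolding h_def g_def by (metis nonzero_mult_div_cancel_right not_gr_zero)
    moreover have "g = l * h" using l unfolding h_def g_def by simp
    moreover have "w 2 = (w 2 div h) * h" unfolding h_def by simp
    ultimately have "l * h dvd (e * (w 2 div h)) * h" by (metis mult.assoc)
    then have "l dvd e * (w 2 div h)" using \<open>h > 0\<close> by simp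
    then have "l dvd e" using \<open>coprime (g div h) (w 2 div h)\<close> \<open>g div h = l\<close> by (simp add: coprime_dvd_mult_left_iff)
    then obtain k where k: "e = k * l" by (metis dvdE mult.commute)
    have "e * w 2 = k * s * w 1 + k * t * w 3"
      using combination unfolding k by (metis (no_types, lifting) distrib_left mult.assoc)
    then have eq'': "(a + k * s) * w 1 + (c + k * t) * w 3 = a' * w 1 + c' * w 3"
      using eq' by (simp add: algebra_simps)
    have "binom_rel J ((Poly_Mapping.single 2 b' + Poly_Mapping.single 1 a + Poly_Mapping.single 3 c) + Poly_Mapping.single 2 (k * l))
      ((Poly_Mapping.single 2 b' + Poly_Mapping.single 1 a + Poly_Mapping.single 3 c) + (Poly_Mapping.single 1 (k * s) + Poly_Mapping.single 3 (k * t)))"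
      by (rule binom_rel_shift[OF J step]) (use n123 in simp)
    then have "binom_rel J (N a b c) (N (a + k * s) b' (c + k * t))"
      unfolding N_def e k by (simp add: single_add ac_simps)
    moreover have "binom_rel J (N (a + k * s) b' (c + k * t)) (N a' b' c')"
      unfolding N_def by (rule binom_rel_shift[OF J two[OF eq'']]) (use n123 in simp)
    ultimately show ?thesis by (rule binom_rel_trans[OF J])
  qed
  have N_lookup: "m = N (Poly_Mapping.lookup m 1) (Poly_Mapping.lookup m 2) (Poly_Mapping.lookup m 3)" if "m \<in> exps 3" for m
  proof (rule exps_eqI[OF that N_exps])
    fix i assume "i \<in> {1..3::nat}"
    then consider "i = 1" | "i = 2" | "i = 3" by fastforce
    then show "Poly_Mapping.lookup m i = Poly_Mapping.lookup (N (Poly_Mapping.lookup m 1) (Poly_Mapping.lookup m 2) (Poly_Mapping.lookup m 3)) i"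
      by cases (auto simp: N_def lookup_add lookup_single)
  qed
  show ?thesis
  proof (rule toric_complete_intersectionI[OF pos _ _ _ G_sub])
    show "finite G" unfolding G_def by simp
    show "card G \<le> 3 - 1" unfolding G_def by (simp add: card_insert_if)
    fix m m' assume m: "m \<in> exps 3" "m' \<in> exps 3" "wdeg 3 w m = wdeg 3 w m'"
    have "binom_rel J m m'"
      using main binom_rel_sym[OF J] N_lookup[OF m(1)] N_lookup[OF m(2)] m(3) N_deg
      by (metis nat_le_linear)
    then show "Poly_Mapping.single m 1 - Poly_Mapping.single m' 1 \<in> genideal (mpoly_ring 3) G"
      unfolding binom_rel_def J_def .
  qed simp_all
qed

section \<open>Complete intersections\<close>

text \<open>The coefficient of \<open>v\<close> is determined modulo \<open>u div gcd u v\<close>;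
  its least representative is small enough for the remainder to be nonnegative.\<close>

lemma nat_combination_if_large:
  fixes u v x :: nat
  assumes "u > 0" "v > 0" "gcd u v dvd x" and le: "(u div gcd u v) * v \<le> x"
  shows "\<exists>s t. x = s * u + t * v"
proof -
  define g where "g = gcd u v"
  have g: "g > 0" "g dvd u" "g dvd v" using assms unfolding g_def by auto
  obtain k where k: "x = g * k" using assms(3) unfolding g_def by blast
  obtain i j where ij: "v * i = u * j + gcd v u" using bezout_nat[of v u] assms(2) by auto
  \<comment> \<open>By Bezout \<open>i * k * v\<close> is congruent to \<open>x\<close> modulo
    \<open>u\<close>; reducing the coefficient modulo \<open>u div g\<close> keeps this
    congruence.\<close>
  define c where "c = (i * k) mod (u div g)"
  have "u div g > 0" using g assms(1) by (simp add: div_greater_zero_iff dvd_imp_le)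
  then have "c * v \<le> (u div g) * v" unfolding c_def by (intro mult_le_mono1) (simp add: less_imp_le)
  then have cv: "c * v \<le> x" using le unfolding g_def by (rule le_trans)
  have "int u dvd int x - int (c * v)"
  proof -
    have "i * k = c + (u div g) * ((i * k) div (u div g))" unfolding c_def by simp
    then have ik: "int (i * k * v) = int (c * v) + int u * (int (v div g) * int ((i * k) div (u div g)))"
    proof -
      have uv: "(u div g) * v = u * (v div g)" using g by (metis div_mult_swap dvd_div_mult)
      have "i * k * v = (c + (u div g) * ((i * k) div (u div g))) * v"
        using \<open>i * k = _\<close> by (rule arg_cong)
      also have "\<dots> = c * v + ((u div g) * v) * ((i * k) div (u div g))" by (simp add: algebra_simps)
      finally show ?thesis unfolding uv by simp
    qed
    have "int (i * k * v) = int u * (int j * int k) + int x"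
      using arg_cong[OF ij, of "\<lambda>z. int (z * k)"] k unfolding g_def
      by (simp add: algebra_simps gcd.commute)
    then have "int x - int (c * v) = int u * (int (v div g) * int ((i * k) div (u div g)) - int j * int k)"
      using ik by (simp add: algebra_simps)
    then show ?thesis by simp
  qed
  then have "u dvd x - c * v" using cv by (simp add: of_nat_diff flip: int_dvd_int_iff)
  then obtain s where "x - c * v = u * s" by blast
  then have "x = s * u + c * v" using cv by (simp add: mult.commute)
  then show ?thesis by blast
qed

context
  fixes p q h a d :: nat
  assumes pq: "p > 0" "q > 0" "coprime p q" and pos: "h > 0" "a > 0" "d > 0"
begin

lemma gcd_first_two: "gcd (pq_fib p q a) (pq_fib p q (h * a + d)) = pq_fib p q (gcd a d)"
  using pq_fib_gcd[OF pq(3), of a "h * a + d"] gcd_add_mult[of a h d] by simp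

text \<open>\<open>F a <= F (k d)\<close> and
  \<open>F (k d) F (h a + d) <= F (h a + (k + 1) d)\<close> give the size condition of
  \<open>nat_combination_if_large\<close>.\<close>

lemma combination_if_long:
  assumes "a \<le> k * d"
  shows "\<exists>s t. pq_fib p q (h * a + Suc k * d) = s * pq_fib p q a + t * pq_fib p q (h * a + d)"
proof (rule nat_combination_if_large)
  show "pq_fib p q a > 0" "pq_fib p q (h * a + d) > 0" using pq pos by (simp_all add: pq_fib_pos)
  show "gcd (pq_fib p q a) (pq_fib p q (h * a + d)) dvd pq_fib p q (h * a + Suc k * d)"
    unfolding gcd_first_two by (intro pq_fib_dvd pq dvd_add dvd_mult) auto
  have "pq_fib p q a div gcd (pq_fib p q a) (pq_fib p q (h * a + d)) * pq_fib p q (h * a + d) \<le> pq_fib p q (k * d) * pq_fib p q (h * a + d)"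
    using pq_fib_mono[OF pq(1) assms, of q] by (intro mult_le_mono1) (meson div_le_dividend le_trans)
  also have "\<dots> \<le> pq_fib p q (h * a + Suc k * d)"
    using pq_fib_mult_le'[OF pq(1), of q "k * d" "h * a + d"] by (simp add: ac_simps)
  finally show "pq_fib p q a div gcd (pq_fib p q a) (pq_fib p q (h * a + d)) * pq_fib p q (h * a + d) \<le> pq_fib p q (h * a + Suc k * d)" .
qed

text \<open>For odd \<open>d\<close> the recurrence with step \<open>d\<close> has nonnegative
  coefficients. It starts from \<open>F (h a)\<close>, a multiple of \<open>F a\<close>, and
  \<open>F (h a + d)\<close>.\<close>

lemma combination_if_odd:
  assumes "odd d"
  shows "\<exists>s t. pq_fib p q (h * a + k * d) = s * pq_fib p q a + t * pq_fib p q (h * a + d)"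
proof -
  let ?P = "\<lambda>k. \<exists>s t. pq_fib p q (h * a + k * d) = s * pq_fib p q a + t * pq_fib p q (h * a + d)"
  have "?P k \<and> ?P (Suc k)"
  proof (induction k)
    case 0
    obtain c where "pq_fib p q (h * a) = pq_fib p q a * c" using pq_fib_dvd[OF pq(3), of a "h * a"] by auto
    then have "pq_fib p q (h * a + 0 * d) = c * pq_fib p q a + 0 * pq_fib p q (h * a + d)" by simp
    moreover have "pq_fib p q (h * a + Suc 0 * d) = 0 * pq_fib p q a + 1 * pq_fib p q (h * a + d)" by simp
    ultimately show ?case by blast
  next
    case (Suc k)
    then obtain s t s' t' where st: "pq_fib p q (h * a + k * d) = s * pq_fib p q a + t * pq_fib p q (h * a + d)"
      "pq_fib p q (h * a + Suc k * d) = s' * pq_fib p q a + t' * pq_fib p q (h * a + d)" by blast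
    have "int (pq_fib p q (h * a + Suc (Suc k) * d)) = int (pq_lucas p q d * pq_fib p q (h * a + Suc k * d) + q ^ d * pq_fib p q (h * a + k * d))"
    proof -
      have "h * a + Suc (Suc k) * d = h * a + k * d + 2 * d" "h * a + Suc k * d = h * a + k * d + d" by simp_all
      then show ?thesis
        using pq_fib_step[OF pos(3), of p q "h * a + k * d"] assms by (simp only: of_nat_add of_nat_mult) simp
    qed
    then have "pq_fib p q (h * a + Suc (Suc k) * d) = pq_lucas p q d * pq_fib p q (h * a + Suc k * d) + q ^ d * pq_fib p q (h * a + k * d)"
      by linarith
    then have "pq_fib p q (h * a + Suc (Suc k) * d) = (pq_lucas p q d * s' + q ^ d * s) * pq_fib p q a + (pq_lucas p q d * t' + q ^ d * t) * pq_fib p q (h * a + d)"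
      unfolding st by (simp add: algebra_simps)
    then show ?case using Suc by blast
  qed
  then show ?thesis by blast
qed

text \<open>Put \<open>e = a - d\<close>, an odd divisor of \<open>d\<close>, and
  \<open>m = F a / F e\<close>; since \<open>e\<close> is odd, \<open>m <= L\<close>. Subtracting
  \<open>(L - m) F (h a + d)\<close> leaves \<open>m F (h a + d) - q ^ d F (h a)\<close>, where both
  terms are multiples of \<open>F a\<close>, the first because \<open>F e\<close> divides
  \<open>F (h a + d)\<close>.\<close>

lemma combination_if_gcd:
  assumes "even d" "odd a" and gcd: "int (gcd a d) = int a - int d"
  shows "\<exists>s t. pq_fib p q (h * a + 2 * d) = s * pq_fib p q a + t * pq_fib p q (h * a + d)"
proof -
  define e where "e = gcd a d"
  have e: "a = d + e" "e dvd a" "e dvd d" "e > 0" "e \<le> d" "odd e"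
    using gcd assms pos unfolding e_def by (auto simp: dvd_imp_le)
  let ?L = "pq_lucas p q d"
  have Fe: "pq_fib p q e > 0" using pq e by (simp add: pq_fib_pos)
  obtain m where m: "pq_fib p q a = pq_fib p q e * m" using pq_fib_dvd[OF pq(3) e(2)] by blast
  have "int (pq_fib p q a) \<le> int (?L * pq_fib p q e)"
    using pq_fib_add_lucas[OF e(4,5), of p q] e(1,6) by simp
  then have "m \<le> ?L" using Fe unfolding m by (simp add: mult.commute)
  have "pq_fib p q e * pq_fib p q (Suc d) \<le> pq_fib p q e * m" unfolding m[symmetric] e(1)
    using pq_fib_mult_le[OF pq(1), of q e d] by (simp add: add.commute)
  then have "m \<ge> pq_fib p q (Suc d)" using Fe by simp
  \<comment> \<open>The bound \<open>m >= F (d + 1)\<close> keeps \<open>L - m\<close> small enough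
    for the remainder to be nonnegative.\<close>
  then have "?L - m \<le> q * pq_fib p q (d - 1)" unfolding pq_lucas_def by simp
  also have "\<dots> \<le> pq_fib p q (Suc d)" using pos(3) by (cases d) simp_all
  finally have "(?L - m) * pq_fib p q (h * a + d) \<le> pq_fib p q (Suc d) * pq_fib p q (h * a + d)" by simp
  also have "\<dots> \<le> pq_fib p q (h * a + 2 * d)"
    using pq_fib_mult_le[OF pq(1), of q "h * a + d" d] by (simp add: ac_simps mult_2_right)
  finally have le: "(?L - m) * pq_fib p q (h * a + d) \<le> pq_fib p q (h * a + 2 * d)" .
  obtain z where z: "pq_fib p q (h * a + d) = pq_fib p q e * z" using pq_fib_dvd[OF pq(3), of e "h * a + d"] e by auto
  obtain y where y: "pq_fib p q (h * a) = pq_fib p q a * y" using pq_fib_dvd[OF pq(3), of a "h * a"] by auto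
  have "int (pq_fib p q (h * a + 2 * d)) - int ((?L - m) * pq_fib p q (h * a + d)) = int m * int (pq_fib p q (h * a + d)) - int (q ^ d) * int (pq_fib p q (h * a))"
    using pq_fib_step[OF pos(3), of p q "h * a"] assms(1) \<open>m \<le> ?L\<close> by (simp add: of_nat_diff algebra_simps)
  also have "\<dots> = int (pq_fib p q a) * (int z - int (q ^ d) * int y)" unfolding y z by (simp add: m algebra_simps)
  finally have "int (pq_fib p q a) dvd int (pq_fib p q (h * a + 2 * d) - (?L - m) * pq_fib p q (h * a + d))"
    using le by (simp add: of_nat_diff)
  then obtain s where "pq_fib p q (h * a + 2 * d) - (?L - m) * pq_fib p q (h * a + d) = pq_fib p q a * s" by (auto simp: int_dvd_int_iff)
  then have "pq_fib p q (h * a + 2 * d) = s * pq_fib p q a + (?L - m) * pq_fib p q (h * a + d)" using le by (simp add: mult.commute)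
  then show ?thesis by blast
qed

lemma toric_complete_intersection_pq_fib:
  assumes "n \<ge> 3" and w1: "w 1 = pq_fib p q a" and w: "\<And>i. i \<in> {2..n} \<Longrightarrow> w i = pq_fib p q (h * a + (i - 1) * d)"
    and cond: "odd d \<or> d \<ge> a \<or> a = 2 * d \<or> (int (gcd a d) = int a - int d \<and> odd a) \<or> (n = 3 \<and> 2 * d dvd a)"
  shows "toric_complete_intersection TYPE('k::field) n w"
proof -
  have w_pos: "w i > 0" if "i \<in> {1..n}" for i
    using that w[of i] w1 pq pos by (cases "i = 1") (auto intro!: pq_fib_pos)
  have two: ?thesis if *: "\<And>k. k \<ge> 2 \<Longrightarrow> \<exists>s t. pq_fib p q (h * a + k * d) = s * pq_fib p q a + t * pq_fib p q (h * a + d)"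
  proof (rule toric_complete_intersection_two_generators[OF w_pos])
    show "n \<ge> 2" using \<open>n \<ge> 3\<close> by simp
    fix i assume i: "i \<in> {3..n}"
    then have "2 \<le> i - 1" unfolding atLeastAtMost_iff by linarith
    from *[OF this] show "\<exists>s t. w i = s * w 1 + t * w 2"
      using w[of i] w[of 2] w1 i by simp
  qed
  \<comment> \<open>Once \<open>a <= 2 * d\<close>, only \<open>k = 2\<close> needs an argument of
    its own.\<close>
  have from_3: "\<exists>s t. pq_fib p q (h * a + k * d) = s * pq_fib p q a + t * pq_fib p q (h * a + d)" if a: "a \<le> 2 * d" and k: "k \<ge> 3" for k
  proof -
    obtain j where j: "k = Suc j" "j \<ge> 2" using k by (cases k) auto
    have "a \<le> j * d" using a mult_le_mono1[OF j(2), of d] by linarith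
    then show ?thesis using combination_if_long[of j] j(1) by simp
  qed
  consider "odd d" | "d \<ge> a" | "a = 2 * d" | "even d" "int (gcd a d) = int a - int d" "odd a"
    | "even d" "n = 3" "2 * d dvd a" using cond by blast
  then show ?thesis
  proof cases
    case 1
    then show ?thesis using two combination_if_odd by blast
  next
    case 2
    show ?thesis
    proof (rule two)
      fix k :: nat assume k: "k \<ge> 2"
      then obtain j where j: "k = Suc j" "j \<ge> 1" by (cases k) auto
      then have "a \<le> j * d" using 2 by (metis le_trans mult_le_mono1 nat_mult_1)
      then show "\<exists>s t. pq_fib p q (h * a + k * d) = s * pq_fib p q a + t * pq_fib p q (h * a + d)" using combination_if_long j by simp
    qed
  next
    case 3
    \<comment> \<open>Here \<open>h a + 2 d = (h + 1) a\<close>.\<close>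
    have "pq_fib p q a dvd pq_fib p q (h * a + 2 * d)" using 3 by (intro pq_fib_dvd pq) simp
    then obtain c where "pq_fib p q (h * a + 2 * d) = pq_fib p q a * c" by (rule dvdE)
    then have "pq_fib p q (h * a + 2 * d) = c * pq_fib p q a + 0 * pq_fib p q (h * a + d)" by (simp add: mult.commute)
    then have k2: "\<exists>s t. pq_fib p q (h * a + 2 * d) = s * pq_fib p q a + t * pq_fib p q (h * a + d)" by blast
    have "\<exists>s t. pq_fib p q (h * a + k * d) = s * pq_fib p q a + t * pq_fib p q (h * a + d)" if "k \<ge> 2" for k
      using from_3[of k] 3 that k2 by (cases "k = 2") auto
    then show ?thesis by (rule two)
  next
    case 4
    have "gcd a d \<le> d" using pos by (simp add: dvd_imp_le)
    then have "a \<le> 2 * d" using 4 by linarith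
    then have "\<exists>s t. pq_fib p q (h * a + k * d) = s * pq_fib p q a + t * pq_fib p q (h * a + d)" if "k \<ge> 2" for k
      using from_3[of k] combination_if_gcd[OF 4(1,3,2)] that by (cases "k = 2") auto
    then show ?thesis by (rule two)
  next
    case 5
    have w2: "w 2 = pq_fib p q (h * a + d)" and w3: "w 3 = pq_fib p q (h * a + 2 * d)" using w[of 2] w[of 3] 5(2) by simp_all
    obtain c where c: "pq_fib p q (h * a) = pq_fib p q a * c" using pq_fib_dvd[OF pq(3), of a "h * a"] by auto
    have "toric_complete_intersection TYPE('k) 3 w"
    proof (rule toric_complete_intersection_gluing)
      show "w i > 0" if "i \<in> {1..3}" for i using w_pos[of i] that 5 by simp
      have "int (pq_lucas p q d * w 2) = int (q ^ d * c * w 1 + 1 * w 3)"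
        using pq_fib_step[OF pos(3), of p q "h * a"] 5(1) c unfolding w1 w2 w3 by (simp add: algebra_simps)
      then show "pq_lucas p q d * w 2 = q ^ d * c * w 1 + 1 * w 3" by linarith
      \<comment> \<open>As \<open>2 d\<close> divides \<open>a\<close>, the pair has gcd
        \<open>F (2 d)\<close> and all three weights have gcd \<open>F d\<close>; the quotient is
        \<open>L\<close>, the factor in the relation.\<close>
      have g13: "gcd (w 1) (w 3) = pq_fib p q (2 * d)"
        unfolding w1 w3 pq_fib_gcd[OF pq(3)] gcd_add_mult using 5 by (simp add: gcd_proj2_iff)
      obtain j where j: "a = 2 * d * j" using 5(3) by blast
      have "gcd (2 * d) (h * a + d) = gcd (2 * d) d"
        using gcd_add_mult[of "2 * d" "h * j" d] unfolding j by (simp add: ac_simps)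
      then have "gcd (pq_fib p q (2 * d)) (w 2) = pq_fib p q d"
        unfolding w2 pq_fib_gcd[OF pq(3)] by (simp add: gcd_proj2_iff)
      then show "pq_lucas p q d * gcd (gcd (w 1) (w 3)) (w 2) = gcd (w 1) (w 3)"
        unfolding g13 by (simp add: pq_fib_double[OF pos(3)])
    qed
    then show ?thesis using 5(2) by simp
  qed
qed

end

section \<open>Critical exponents and the converse\<close>

definition crit :: "nat \<Rightarrow> (nat \<Rightarrow> nat) \<Rightarrow> nat \<Rightarrow> nat" where
  "crit n w i = (LEAST c. c > 0 \<and> (\<exists>u\<in>exps n. Poly_Mapping.lookup u i = 0 \<and> wdeg n w u = c * w i))"

lemma crit_le:
  assumes "c > 0" "u \<in> exps n" "Poly_Mapping.lookup u i = 0" "wdeg n w u = c * w i"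
  shows "crit n w i \<le> c"
  unfolding crit_def by (rule Least_le) (use assms in blast)

text \<open>The set under \<open>LEAST\<close> is nonempty because \<open>w j\<close> copies of
  \<open>w i\<close> equal \<open>w i\<close> copies of \<open>w j\<close>.\<close>

lemma crit_props:
  assumes pos: "\<And>i. i \<in> {1..n} \<Longrightarrow> w i > 0" and i: "i \<in> {1..n}" and "n \<ge> 2"
  shows "crit n w i > 0" "\<exists>u\<in>exps n. Poly_Mapping.lookup u i = 0 \<and> wdeg n w u = crit n w i * w i"
proof -
  obtain j where j: "j \<in> {1..n}" "j \<noteq> i" using \<open>n \<ge> 2\<close> by (cases "i = 1") (auto intro: that[of 1] that[of 2])
  have "w j > 0 \<and> (\<exists>u\<in>exps n. Poly_Mapping.lookup u i = 0 \<and> wdeg n w u = w j * w i)"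
    using j pos[OF j(1)] by (auto intro!: bexI[of _ "Poly_Mapping.single j (w i)"] simp: lookup_single)
  then have "crit n w i > 0 \<and> (\<exists>u\<in>exps n. Poly_Mapping.lookup u i = 0 \<and> wdeg n w u = crit n w i * w i)"
    unfolding crit_def by (rule LeastI)
  then show "crit n w i > 0" "\<exists>u\<in>exps n. Poly_Mapping.lookup u i = 0 \<and> wdeg n w u = crit n w i * w i"
    by blast+
qed

lemma wdeg_eq_0:
  assumes "\<And>i. i \<in> {1..n} \<Longrightarrow> w i > 0" "u \<in> exps n" "wdeg n w u = 0"
  shows "u = 0"
  by (rule exps_eqI[OF assms(2) zero_in_exps]) (use assms in \<open>force simp: wdeg_def\<close>)

text \<open>If another monomial of this degree contained \<open>x_i\<close>, cancelling that power
  of \<open>x_i\<close> would leave a relation with a smaller exponent, against minimality.\<close>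

lemma isolated_crit:
  assumes pos: "\<And>i. i \<in> {1..n} \<Longrightarrow> w i > 0" and i: "i \<in> {1..n}"
  shows "isolated n w (Poly_Mapping.single i (crit n w i))"
  unfolding isolated_def
proof (intro ballI impI, elim conjE)
  fix u assume u: "u \<in> exps n" "wdeg n w u = wdeg n w (Poly_Mapping.single i (crit n w i))"
    "u \<noteq> Poly_Mapping.single i (crit n w i)"
  have deg: "wdeg n w u = crit n w i * w i" using u(2) i by simp
  define v where "v = Poly_Mapping.update i 0 u"
  define c where "c = Poly_Mapping.lookup u i"
  have uv: "u = Poly_Mapping.single i c + v"
    by (rule poly_mapping_eqI) (auto simp: v_def c_def lookup_add lookup_single lookup_update when_def)
  have "Poly_Mapping.single i c + v \<in> exps n" unfolding uv[symmetric] by (rule u(1))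
  then have v: "v \<in> exps n" "Poly_Mapping.lookup v i = 0" by (simp_all add: v_def lookup_update)
  have deg': "c * w i + wdeg n w v = crit n w i * w i"
    using deg i by (subst (asm) uv) (simp add: wdeg_add)
  have "c = 0"
  proof (rule ccontr)
    assume "c \<noteq> 0"
    have "c * w i \<le> crit n w i * w i" using deg' by linarith
    then have "c \<le> crit n w i" using pos[OF i] by simp
    have "crit n w i - c > 0"
    proof (rule ccontr)
      assume "\<not> ?thesis"
      then have eq: "c = crit n w i" using \<open>c \<le> _\<close> by simp
      then have "v = 0" using deg' eq wdeg_eq_0[OF pos v(1)] by simp
      then show False using u(3) uv eq by simp
    qed
    moreover have "wdeg n w v = (crit n w i - c) * w i" using deg' by (simp add: diff_mult_distrib)
    ultimately have "crit n w i \<le> crit n w i - c" using crit_le v by blast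
    then show False using \<open>c \<noteq> 0\<close> \<open>crit n w i - c > 0\<close> by linarith
  qed
  then show "Poly_Mapping.keys u \<inter> Poly_Mapping.keys (Poly_Mapping.single i (crit n w i)) = {}"
    unfolding c_def by (auto simp: in_keys_iff lookup_single when_def split: if_splits)
qed

text \<open>If two critical degrees agree, each weight divides the critical degree of the other;
  this turns the divisibility into a size estimate.\<close>

lemma dvd_mult_le_gcd:
  fixes u v c :: nat
  assumes "v dvd c * u" "c > 0" "v > 0"
  shows "v \<le> c * gcd u v"
proof -
  have "v dvd gcd (c * u) (c * v)" using assms by simp
  then have "v dvd c * gcd u v" by (simp add: gcd_mult_distrib_nat)
  then show ?thesis using assms by (intro dvd_imp_le) (auto intro: Nat.gr0I)
qed

text \<open>For \<open>a > 2 d\<close> compare with \<open>L F d = F (2 d)\<close>. Otherwise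
  \<open>a = d + e\<close> with \<open>e < d\<close>, the gcd is at most an even
  \<open>s <= e\<close>, and for even \<open>s\<close> the correction in
  \<open>pq_fib_add_lucas\<close> is positive.\<close>

lemma lucas_times_gcd_less:
  assumes pq: "p > 0" "q > 0" and d: "even d" "d > 0" and a: "d < a" "a \<noteq> 2 * d"
    and gcd: "\<not> (int (gcd a d) = int a - int d \<and> odd a)"
  shows "pq_lucas p q d * pq_fib p q (gcd a d) < pq_fib p q a"
proof (cases "a > 2 * d")
  case True
  have "gcd a d \<le> d" using d by (simp add: dvd_imp_le)
  then have "pq_lucas p q d * pq_fib p q (gcd a d) \<le> pq_lucas p q d * pq_fib p q d"
    using pq by (intro mult_le_mono2 pq_fib_mono)
  also have "\<dots> = pq_fib p q (2 * d)" using pq_fib_double[OF d(2)] by simp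
  also have "\<dots> < pq_fib p q a" using True d pq by (intro pq_fib_less) auto
  finally show ?thesis .
next
  case False
  define e where "e = a - d"
  have e: "a = d + e" "0 < e" "e < d" using False a unfolding e_def by auto
  \<comment> \<open>For odd \<open>e\<close> the excluded case is exactly
    \<open>gcd a d = e\<close>, so one may step down to the even number
    \<open>e - 1\<close>.\<close>
  define s where "s = (if even e then e else e - 1)"
  have "gcd a d dvd e" unfolding e(1) by (metis dvd_add_right_iff gcd_dvd1 gcd_dvd2)
  then have "gcd a d \<le> e" using e(2) by (rule dvd_imp_le)
  moreover have "odd e \<Longrightarrow> gcd a d \<noteq> e" using gcd e d by auto
  ultimately have gs: "gcd a d \<le> s" unfolding s_def by auto
  have "gcd a d > 0" using d by simp
  then have "0 < s" using gs by linarith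
  moreover have "s \<le> e" "even s" using e(2) unfolding s_def by auto
  ultimately have s: "0 < s" "s \<le> e" "even s" by auto
  have "int (pq_lucas p q d * pq_fib p q s) < int (pq_fib p q (d + s))"
    using pq_fib_add_lucas[of s d p q] s e pq pq_fib_pos[of p "d - s" q] by simp
  then have "pq_lucas p q d * pq_fib p q s < pq_fib p q (d + s)" by linarith
  moreover have "pq_fib p q (d + s) \<le> pq_fib p q a" using s e pq by (intro pq_fib_mono) auto
  moreover have "pq_lucas p q d * pq_fib p q (gcd a d) \<le> pq_lucas p q d * pq_fib p q s"
    using gs pq by (intro mult_le_mono2 pq_fib_mono)
  ultimately show ?thesis by linarith
qed

text \<open>Terms of a sequence \<open>y\<^bsub>k + 2\<^esub> = L y\<^bsub>k + 1\<^esub> - Q y\<^sub>k\<close>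
  with real characteristic roots of the same sign.\<close>

lemma second_order_bounds:
  fixes L Q t y x2 x3 x4 x5 :: int
  assumes L: "L \<ge> 3" and Q: "Q \<ge> 1" "4 * Q \<le> L\<^sup>2" and t: "t \<ge> 0" "t * L < Q"
    and y: "y > 0" and x2: "L * y \<le> 2 * x2" and x3: "x3 = L * x2 - Q * y" "L * x2 \<le> 2 * x3"
    and x4: "x4 = L * x3 - Q * x2" "L * x3 \<le> 2 * x4" and x5: "x5 = L * x4 - Q * x3" "L * x4 \<le> 2 * x5"
  shows "(t + 1) * Q * y < x4" "(t + 1) * Q * y + x4 < x5"
proof -
  \<comment> \<open>In the application \<open>y\<close> is \<open>F (h a)\<close>, \<open>x2\<close>
    to \<open>x5\<close> are the following terms with step \<open>d\<close>, and \<open>t\<close> is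
    the quotient of \<open>Q\<close> by \<open>L\<close>.\<close>
  have x2p: "x2 > 0" using x2 L y mult_pos_pos[of L y] by linarith
  have x3p: "x3 > 0" using x3(2) L x2p mult_pos_pos[of L x2] by linarith
  have x4p: "x4 > 0" using x4(2) L x3p mult_pos_pos[of L x3] by linarith
  have "L * (L * y) \<le> L * (2 * x2)" using L x2 by (intro mult_left_mono) auto
  then have y3: "L * (L * y) \<le> 4 * x3" using x3(2) by linarith
  have "L * (L * (L * y)) \<le> L * (4 * x3)" using L y3 by (intro mult_left_mono) auto
  then have y4: "L * (L * (L * y)) \<le> 8 * x4" using x4(2) by linarith
  \<comment> \<open>Integrality turns \<open>t L < Q\<close> into
    \<open>(t + 1) L <= Q + L - 1\<close>; then \<open>4 Q <= L^2\<close> removes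
    \<open>Q\<close>.\<close>
  have "8 * Q * ((t + 1) * L) \<le> 8 * Q * (Q + L - 1)"
    using Q t by (intro mult_left_mono) (auto simp: algebra_simps)
  also have "\<dots> = 2 * (4 * Q) * (Q + L - 1)" by simp
  also have "\<dots> \<le> 2 * L\<^sup>2 * (Q + L - 1)" using Q L by (intro mult_right_mono) auto
  also have "\<dots> = L\<^sup>2 * (4 * Q) div 2 + 2 * L\<^sup>2 * (L - 1)" by (simp add: algebra_simps)
  also have "\<dots> \<le> L\<^sup>2 * L\<^sup>2 div 2 + 2 * L\<^sup>2 * (L - 1)"
    using Q by (intro add_right_mono zdiv_mono1 mult_left_mono) auto
  finally have *: "16 * Q * ((t + 1) * L) \<le> L\<^sup>2 * L\<^sup>2 + 4 * L\<^sup>2 * (L - 1)" by linarith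
  have "0 < L\<^sup>2 * (L - 2)\<^sup>2" using L by simp
  then have "L\<^sup>2 * L\<^sup>2 + 4 * L\<^sup>2 * (L - 1) < 2 * (L\<^sup>2 * L\<^sup>2)"
    by (simp add: power2_eq_square algebra_simps)
  with * have "L * (8 * Q * (t + 1)) < L * (L * (L * L))" by (simp add: power2_eq_square algebra_simps)
  then have "8 * Q * (t + 1) < L * (L * L)" using L by simp
  then have "8 * Q * (t + 1) * y < L * (L * L) * y" using y by simp
  then show 1: "(t + 1) * Q * y < x4" using y4 by (simp add: algebra_simps)
  show "(t + 1) * Q * y + x4 < x5"
  proof (cases "L \<ge> 4")
    case True
    then have "4 * x4 \<le> L * x4" using x4p by simp
    then show ?thesis using 1 x5(2) by linarith
  next
    case False
    \<comment> \<open>For \<open>L = 3\<close> the growth estimate is too weak, but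
      \<open>4 Q <= 9\<close> leaves two values of \<open>Q\<close>, both with
      \<open>t = 0\<close>.\<close>
    then have L3: "L = 3" using L by simp
    then have Q2: "Q = 1 \<or> Q = 2" using Q by auto
    then have "t = 0" using t L3 by auto
    then show ?thesis using Q2 L3 x2 x2p y unfolding x5(1) x4(1) x3(1) by auto
  qed
qed

section \<open>The weights for even \<open>d\<close> with \<open>d < a\<close>\<close>

context
  fixes p q h a d n :: nat and w :: "nat \<Rightarrow> nat"
  assumes pq: "p > 0" "q > 0" "coprime p q" and pos: "h > 0" "a > 0" "d > 0" and n: "n \<ge> 3"
    and w1: "w 1 = pq_fib p q a" and w: "\<And>i. i \<in> {2..n} \<Longrightarrow> w i = pq_fib p q (h * a + (i - 1) * d)"
    and d_even: "even d" and da: "d < a"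
begin

private abbreviation (input) "F \<equiv> pq_fib p q"
private abbreviation (input) "L \<equiv> pq_lucas p q d"
text \<open>The index is shifted: \<open>W k\<close> is \<open>w (k + 1)\<close> for
  \<open>k\<close> from 1 to \<open>n - 1\<close>, while \<open>W 0 = F (h a)\<close> is a multiple
  of \<open>w 1\<close> that starts the recurrence.\<close>

private abbreviation (input) "W k \<equiv> pq_fib p q (h * a + k * d)"

lemma w_pos: "i \<in> {1..n} \<Longrightarrow> w i > 0"
  using w[of i] w1 pq pos by (cases "i = 1") (auto intro!: pq_fib_pos)

lemma W_pos: "W k > 0"
  using pq pos by (intro pq_fib_pos) auto

lemma w_W: "k \<in> {1..n - 1} \<Longrightarrow> w (Suc k) = W k"
  using w[of "Suc k"] by fastforce

lemma W_rec: "W (Suc (Suc k)) + q ^ d * W k = L * W (Suc k)"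
proof -
  have "h * a + Suc (Suc k) * d = h * a + k * d + 2 * d" "h * a + Suc k * d = h * a + k * d + d" by simp_all
  then have "int (W (Suc (Suc k)) + q ^ d * W k) = int (L * W (Suc k))"
    using pq_fib_step[OF pos(3), of p q "h * a + k * d"] d_even by (simp only: of_nat_add of_nat_mult) simp
  then show ?thesis by linarith
qed

lemma W_growth: "L * W k \<le> 2 * W (Suc k)"
  using pq_lucas_mult_le[OF pos(3), of p q "h * a + k * d"] by (simp add: ac_simps)

lemma lucas_ge_3: "L \<ge> 3"
proof -
  have "d \<ge> 2" using d_even pos(3) by (metis One_nat_def Suc_leI dvd_imp_le numeral_2_eq_2)
  then show ?thesis using pq by (intro pq_lucas_ge_3)
qed

lemma lucas_less_W: "1 \<le> k \<Longrightarrow> L < W k"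
proof -
  assume k: "1 \<le> k"
  have "a \<le> h * a" "d \<le> k * d" using pos k by simp_all
  then have "2 * d < h * a + k * d" using da by linarith
  moreover have "3 \<le> h * a + k * d" using calculation pos by linarith
  ultimately have "F (2 * d) < W k" using pq by (intro pq_fib_less)
  then show ?thesis using pq_lucas_le_double[OF pq(1) pos(3), of q] by linarith
qed

lemma W_0: "\<exists>c>0. W 0 = c * w 1"
proof -
  obtain c where "F (h * a) = F a * c" using pq_fib_dvd[OF pq(3), of a "h * a"] by auto
  then show ?thesis using W_pos[of 0] w1 by (intro exI[of _ c]) (auto simp: mult.commute intro: Nat.gr0I)
qed

text \<open>The recurrence expresses \<open>L\<close> copies of a weight by its two neighbours. The
  last weight has no successor, hence \<open>i <= n - 1\<close>; for \<open>i = 2\<close> the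
  predecessor \<open>W 0\<close> is a multiple of \<open>w 1\<close>.\<close>

lemma crit_le_lucas:
  assumes "i \<in> {2..n - 1}"
  shows "crit n w i \<le> L"
proof (cases "i = 2")
  case True
  obtain c where c: "W 0 = c * w 1" using W_0 by blast
  have "wdeg n w (Poly_Mapping.single 3 1 + Poly_Mapping.single 1 (q ^ d * c)) = L * w 2"
    using W_rec[of 0] c w_W[of 1] w_W[of 2] n by (simp add: wdeg_add numeral_2_eq_2 numeral_3_eq_3)
  then show ?thesis unfolding True
    by (rule crit_le[rotated 3]) (use n lucas_ge_3 in \<open>auto simp: lookup_add lookup_single\<close>)
next
  case False
  obtain k where k: "i = Suc (Suc k)" "k \<ge> 1" using assms False by (cases i; cases "i - 1") auto
  have "wdeg n w (Poly_Mapping.single (Suc i) 1 + Poly_Mapping.single (Suc k) (q ^ d)) = L * w i"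
    using W_rec[of k] w_W[of k] w_W[of "Suc k"] w_W[of "Suc (Suc k)"] k assms by (simp add: wdeg_add)
  then show ?thesis
    by (rule crit_le[rotated 3]) (use k assms lucas_ge_3 in \<open>auto simp: lookup_add lookup_single\<close>)
qed

text \<open>Equality would give \<open>w j <= L gcd (w i) (w j) <= L F ((j - i) d)\<close>, whereas
  \<open>w j >= F ((j - i) d) w i\<close> and \<open>w i > L\<close>.\<close>

lemma crit_degrees_distinct:
  assumes ij: "2 \<le> i" "i < j" "j \<le> n"
  shows "crit n w i * w i \<noteq> crit n w j * w j"
proof
  assume eq: "crit n w i * w i = crit n w j * w j"
  define k l where "k = i - 1" and "l = j - i"
  then have k: "i = Suc k" "k \<ge> 1" and l: "j = Suc (k + l)" "l \<ge> 1" using ij by linarith+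
  have wi: "w i = W k" and wj: "w j = W (k + l)" using w_W[of k] w_W[of "k + l"] k l ij by auto
  have "w j dvd crit n w i * w i" using eq by simp
  then have "w j \<le> crit n w i * gcd (w i) (w j)"
    using crit_props(1)[where w = w, OF w_pos] w_pos[of j] ij by (intro dvd_mult_le_gcd) auto
  also have "\<dots> \<le> L * F (l * d)"
  proof (intro mult_le_mono crit_le_lucas)
    have "gcd (h * a + k * d) (h * a + (k + l) * d) dvd l * d"
    proof -
      have "h * a + (k + l) * d = (h * a + k * d) + l * d" by (simp add: algebra_simps)
      then show ?thesis by (metis dvd_add_right_iff gcd_dvd1 gcd_dvd2)
    qed
    then have "gcd (h * a + k * d) (h * a + (k + l) * d) \<le> l * d" using l pos by (intro dvd_imp_le) auto
    then show "gcd (w i) (w j) \<le> F (l * d)"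
      unfolding wi wj pq_fib_gcd[OF pq(3)] by (intro pq_fib_mono pq)
  qed (use ij in auto)
  finally have "W (k + l) \<le> L * F (l * d)" unfolding wj .
  moreover have "F (l * d) * W k \<le> W (k + l)"
    using pq_fib_mult_le'[OF pq(1), of q "l * d" "h * a + k * d"] by (simp add: algebra_simps)
  ultimately have "F (l * d) * W k \<le> L * F (l * d)" by linarith
  then have "F (l * d) * W k \<le> F (l * d) * L" by (simp only: mult.commute)
  moreover have "F (l * d) > 0" using pq l pos by (intro pq_fib_pos) auto
  ultimately have "W k \<le> L" by (metis mult_le_cancel1)
  then show False using lucas_less_W[OF k(2)] by simp
qed

text \<open>Equality would give \<open>w 1 <= L F (gcd a d)\<close>, which
  \<open>lucas_times_gcd_less\<close> rules out.\<close>

lemma crit_degree_1_2: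
  assumes "a \<noteq> 2 * d" "\<not> (int (gcd a d) = int a - int d \<and> odd a)"
  shows "crit n w 1 * w 1 \<noteq> crit n w 2 * w 2"
proof
  assume eq: "crit n w 1 * w 1 = crit n w 2 * w 2"
  then have "w 1 dvd crit n w 2 * w 2" by (metis dvd_triv_right)
  then have "w 1 \<le> crit n w 2 * gcd (w 2) (w 1)"
    using crit_props(1)[where w = w, OF w_pos] w_pos[of 1] n by (intro dvd_mult_le_gcd) auto
  also have "\<dots> \<le> L * F (gcd a d)"
    using crit_le_lucas[of 2] w_W[of 1] w1 n gcd_first_two[OF pq pos]
    by (intro mult_le_mono) (auto simp: gcd.commute numeral_2_eq_2)
  finally show False
    using lucas_times_gcd_less[OF pq(1,2) d_even pos(3) da assms] w1 by simp
qed

text \<open>The critical exponent of \<open>x_1\<close> is at most \<open>w 2\<close>, so equality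
  forces \<open>gcd a ((j - 1) d)\<close> above \<open>(j - 2) d\<close>. That is at least half of
  \<open>(j - 1) d\<close>, so the gcd is \<open>(j - 1) d\<close> itself.\<close>

lemma crit_degree_1:
  assumes j: "3 \<le> j" "j \<le> n" and eq: "crit n w 1 * w 1 = crit n w j * w j"
  shows "(j - 1) * d dvd a"
proof -
  obtain k where k: "j = Suc (Suc k)" "k \<ge> 1" using j by (cases j; cases "j - 1") auto
  have wj: "w j = W (Suc k)" using w_W[of "Suc k"] k j by simp
  have w2: "w 2 = W 1" using w_W[of 1] n by (simp add: numeral_2_eq_2)
  define G where "G = gcd a (Suc k * d)"
  have "gcd (w 1) (w j) = F G"
    unfolding w1 wj pq_fib_gcd[OF pq(3)] G_def using gcd_add_mult[of a h "Suc k * d"] by simp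
  have "w j dvd crit n w 1 * w 1" using eq by simp
  then have "w j \<le> crit n w 1 * gcd (w 1) (w j)"
    using crit_props(1)[where w = w, OF w_pos] w_pos[of j] j by (intro dvd_mult_le_gcd) auto
  also have "\<dots> \<le> W 1 * F G"
  proof (intro mult_le_mono)
    have "crit n w 1 \<le> w 2"
      by (rule crit_le[of _ "Poly_Mapping.single 2 (w 1)"])
        (use n w_pos[of 2] in \<open>auto simp: lookup_single mult.commute\<close>)
    then show "crit n w 1 \<le> W 1" using w2 by simp
  qed (use \<open>gcd (w 1) (w j) = F G\<close> in simp)
  finally have "W (Suc k) \<le> W 1 * F G" unfolding wj .
  moreover have "W 1 * F (Suc (k * d)) \<le> W (Suc k)"
    using pq_fib_mult_le[OF pq(1), of q "h * a + 1 * d" "k * d"] by (simp add: algebra_simps)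
  ultimately have "W 1 * F (Suc (k * d)) \<le> W 1 * F G" by linarith
  then have "F (Suc (k * d)) \<le> F G" using W_pos[of 1] by simp
  \<comment> \<open>This puts \<open>Suc (k * d)\<close> in the range where the sequence is strictly
    increasing.\<close>
  have kd: "k * d \<ge> 2"
  proof -
    have "d \<ge> 2" using d_even pos(3) by (metis One_nat_def Suc_leI dvd_imp_le numeral_2_eq_2)
    then show ?thesis using mult_le_mono[OF k(2)] by fastforce
  qed
  have "G > k * d"
  proof (rule ccontr)
    assume "\<not> ?thesis"
    then have "F G < F (Suc (k * d))" using pq kd by (intro pq_fib_less) auto
    then show False using \<open>F (Suc (k * d)) \<le> F G\<close> by simp
  qed
  obtain c where c: "Suc k * d = G * c" unfolding G_def by (metis dvdE gcd_dvd2)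
  have "c < 2"
  proof (rule ccontr)
    assume "\<not> c < 2"
    then have "G * 2 \<le> Suc k * d" unfolding c by simp
    moreover have "Suc k * d \<le> 2 * (k * d)" using k(2) pos by simp
    ultimately show False using \<open>G > k * d\<close> by linarith
  qed
  moreover have "c \<noteq> 0" using c pos by (metis mult_is_0 nat.distinct(1) neq0_conv)
  ultimately have "c = 1" by linarith
  then show ?thesis using c k unfolding G_def by (metis diff_Suc_1 gcd_dvd1 mult.right_neutral)
qed

text \<open>A coincidence of the first critical degree with the \<open>j\<close>-th,
  \<open>j >= 3\<close>, needs \<open>(j - 1) d\<close> to divide \<open>a\<close>; this is excluded
  by \<open>d\<close> not dividing \<open>a\<close>, or for \<open>n = 3\<close> by
  \<open>2 d\<close> not dividing it. All \<open>n\<close> critical powers then have distinct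
  degrees.\<close>

lemma not_complete_intersection_few:
  assumes a: "a \<noteq> 2 * d" "\<not> (int (gcd a d) = int a - int d \<and> odd a)" "\<not> (n = 3 \<and> 2 * d dvd a)"
    and few: "n = 3 \<or> \<not> d dvd a"
  shows "\<not> toric_complete_intersection TYPE('k::field) n w"
proof -
  define \<tau> where "\<tau> i = Poly_Mapping.single i (crit n w i)" for i
  define T where "T = \<tau> ` {1..n}"
  have c_pos: "crit n w i > 0" if "i \<in> {1..n}" for i using crit_props(1)[where w = w, OF w_pos that] n by simp
  have inj: "inj_on \<tau> {1..n}"
    by (rule inj_onI) (metis \<tau>_def c_pos lookup_single_eq lookup_single_not_eq less_numeral_extra(3))
  have distinct: "crit n w i * w i \<noteq> crit n w j * w j" if ij: "1 \<le> i" "i < j" "j \<le> n" for i j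
  proof (cases "i = 1")
    case True
    show ?thesis
    proof (cases "j = 2")
      case False
      have "\<not> (j - 1) * d dvd a"
      proof
        assume *: "(j - 1) * d dvd a"
        then have "d dvd a" by (metis dvd_mult_right)
        then have "n = 3" using few by simp
        then have "j - 1 = 2" using ij True False by simp
        then show False using * a(3) \<open>n = 3\<close> by simp
      qed
      then show ?thesis using crit_degree_1[of j] True False ij by auto
    qed (use crit_degree_1_2[OF a(1,2)] True in simp)
  qed (use crit_degrees_distinct[of i j] ij in simp)
  show ?thesis
  proof (rule not_toric_complete_intersectionI)
    show "n > 0" "finite T" "T \<subseteq> exps n" using n unfolding T_def \<tau>_def by auto
    show "card T = n" unfolding T_def card_image[OF inj] by simp
    fix \<sigma> assume "\<sigma> \<in> T"
    then obtain i where i: "i \<in> {1..n}" "\<sigma> = \<tau> i" unfolding T_def by blast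
    show "isolated n w \<sigma>" unfolding i(2) \<tau>_def using w_pos i(1) by (rule isolated_crit)
    obtain u where u: "u \<in> exps n" "Poly_Mapping.lookup u i = 0" "wdeg n w u = crit n w i * w i"
      using crit_props(2)[where w = w, OF w_pos i(1)] n by auto
    have "u \<notin> T"
    proof
      assume "u \<in> T"
      then obtain j where j: "j \<in> {1..n}" "u = \<tau> j" unfolding T_def by blast
      then have "crit n w j * w j = crit n w i * w i" using u(3) unfolding \<tau>_def by simp
      moreover have "j \<noteq> i" using u(2) j c_pos[of j] unfolding \<tau>_def by auto
      ultimately show False using distinct[of i j] distinct[of j i] i(1) j(1) by (metis atLeastAtMost_iff linorder_neqE_nat)
    qed
    then show "\<exists>u\<in>exps n - T. wdeg n w u = wdeg n w \<sigma>"
      using u i by (intro bexI[of _ u]) (auto simp: \<tau>_def)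
  qed
qed

text \<open>Here \<open>gcd (w 1) (W 1) = F d\<close>, so \<open>z\<close> must be a multiple of
  \<open>F a / F d\<close>.\<close>

lemma multiple_W_1_dvd:
  assumes "d dvd a" "int (w 1) dvd z * int (W 1)"
  shows "z = 0 \<or> int (F a) \<le> \<bar>z\<bar> * int (F d)"
proof (cases "z = 0")
  case False
  have "int (w 1) dvd \<bar>z * int (W 1)\<bar>" using assms(2) by simp
  also have "\<bar>z * int (W 1)\<bar> = int (nat \<bar>z\<bar> * W 1)" by (simp add: abs_mult)
  finally have "w 1 dvd nat \<bar>z\<bar> * W 1" by (simp only: int_dvd_int_iff)
  then have "w 1 \<le> nat \<bar>z\<bar> * gcd (W 1) (w 1)"
    using False w_pos[of 1] n by (intro dvd_mult_le_gcd) auto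
  also have "gcd (W 1) (w 1) = F d"
    using gcd_first_two[OF pq pos] w1 assms(1) by (simp add: gcd.commute gcd_proj1_iff)
  finally have "int (w 1) \<le> int (nat \<bar>z\<bar> * F d)" by linarith
  then show ?thesis using w1 by simp
qed simp

text \<open>The critical degree of \<open>x_1\<close> may now coincide with another one. The
  monomial \<open>v\<close> in \<open>x_2\<close> and \<open>x_3\<close> takes its place; the bulk
  of the proof shows that \<open>v\<close> is isolated.\<close>

lemma not_complete_intersection_many:
  assumes a: "a \<noteq> 2 * d" "d dvd a" and n4: "n \<ge> 4"
  shows "\<not> toric_complete_intersection TYPE('k::field) n w"
proof -
  define Q where "Q = q ^ d"
  define t where "t = Q div L"
  define r where "r = Q mod L"
  have L3: "L \<ge> 3" by (rule lucas_ge_3)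
  have Q: "Q \<ge> 1" "4 * Q \<le> L\<^sup>2"
    unfolding Q_def using pq four_power_le_pq_lucas[OF d_even pos(3)] by auto
  have Qtr: "Q = L * t + r" "r < L" unfolding t_def r_def using L3 by auto
  \<comment> \<open>\<open>L\<close> is coprime to \<open>q\<close> and at least 3, so it cannot
    divide \<open>Q\<close>. This yields \<open>\<alpha> < L\<close>, used at the end of
    \<open>v_unique\<close>.\<close>
  have "r > 0"
  proof (rule ccontr)
    assume "\<not> r > 0"
    then have "L dvd Q" unfolding r_def by auto
    moreover have "coprime L Q" unfolding Q_def using coprime_pq_lucas_q[OF pq(3), of d] by simp
    ultimately have "is_unit L" by (metis coprime_common_divisor dvd_refl)
    then show False using L3 by simp
  qed
  have "t + 1 < L"
  proof -
    have "4 * (L * t) \<le> L * L" using Q(2) Qtr(1) unfolding power2_eq_square by linarith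
    then have "L * (4 * t) \<le> L * L" by (simp only: mult.left_commute)
    then have "4 * t \<le> L" using L3 by (metis mult_le_cancel1 not_numeral_le_zero gr0I)
    then show ?thesis using L3 by linarith
  qed
  obtain c0 where c0: "c0 > 0" "W 0 = c0 * w 1" using W_0 by blast
  have w2: "w 2 = W 1" and w3: "w 3 = W 2" and w4: "w 4 = W 3"
    using w_W[of 1] w_W[of 2] w_W[of 3] n4 by (simp_all add: numeral_eq_Suc)
  have rec: "W 2 + Q * W 0 = L * W 1" "W 3 + Q * W 1 = L * W 2" "W 4 + Q * W 2 = L * W 3"
    using W_rec[of 0] W_rec[of 1] W_rec[of 2] unfolding Q_def by (simp_all add: numeral_eq_Suc)
  define \<alpha> \<beta> where "\<alpha> = L - r" and "\<beta> = L - t - 1"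
  have \<alpha>: "int \<alpha> = int L - int r" "0 < \<alpha>" "\<alpha> < L" using Qtr(2) \<open>r > 0\<close> unfolding \<alpha>_def by auto
  have \<beta>: "int \<beta> = int L - int t - 1" "0 < \<beta>" using \<open>t + 1 < L\<close> unfolding \<beta>_def by auto
  define D where "D = \<alpha> * W 1 + \<beta> * W 2"
  define LL QQ W0 W1 W2 W3 W4 where ints: "LL = int L" "QQ = int Q" "W0 = int (W 0)" "W1 = int (W 1)"
    "W2 = int (W 2)" "W3 = int (W 3)" "W4 = int (W 4)"
  have irec: "W2 = LL * W1 - QQ * W0" "W3 = LL * W2 - QQ * W1" "W4 = LL * W3 - QQ * W2"
    using rec[THEN arg_cong[where f = int]] unfolding ints by auto
  have iQ: "QQ = LL * int t + int r" using Qtr(1) unfolding ints by simp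
  have D_alt: "int D = (int t + 1) * QQ * W0 + W3"
  proof -
    have "int D = (LL - int r) * W1 + (LL - int t - 1) * W2" unfolding D_def ints using \<alpha> \<beta> by simp
    also have "\<dots> = (int t + 1) * QQ * W0 + W3" 
    proof -
      have ir: "int r = QQ - LL * int t" using iQ by simp
      show ?thesis unfolding irec ir by (simp add: algebra_simps)
    qed
    finally show ?thesis .
  qed
  have growth: "LL * W0 \<le> 2 * W1" "LL * W1 \<le> 2 * W2" "LL * W2 \<le> 2 * W3" "LL * W3 \<le> 2 * W4"
    using W_growth[of 0] W_growth[of 1] W_growth[of 2] W_growth[of 3] unfolding ints
    by (simp_all add: numeral_eq_Suc flip: of_nat_mult of_nat_Suc)
  have ipos: "W0 > 0" "W1 > 0" "W2 > 0" "W3 > 0" "W4 > 0" unfolding ints by (simp_all only: of_nat_0_less_iff W_pos)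
  have bounds: "(int t + 1) * QQ * W0 < W3" "(int t + 1) * QQ * W0 + W3 < W4"
  proof -
    have "3 \<le> LL" "1 \<le> QQ" using L3 Q(1) unfolding ints by auto
    moreover have "int (4 * Q) \<le> int (L\<^sup>2)" using Q(2) by linarith
    then have "4 * QQ \<le> LL\<^sup>2" unfolding ints by simp
    moreover have "int t * LL < QQ" unfolding iQ using \<open>r > 0\<close> by (simp add: mult.commute)
    ultimately show "(int t + 1) * QQ * W0 < W3" "(int t + 1) * QQ * W0 + W3 < W4"
      using second_order_bounds[of LL QQ "int t" W0 W1 W2 W3 W4] growth irec ipos by simp_all
  qed
  have LLp: "LL \<ge> 3" using L3 unfolding ints by simp
  have QQp: "QQ \<ge> 1" using Q unfolding ints by simp
  \<comment> \<open>Since \<open>Q = L t + r\<close>, the recurrences give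
    \<open>(L - r) w 2 + (L - t - 1) w 3 = (t + 1) Q F (h a) + w 4\<close>, so \<open>v\<close> and \<open>v'\<close> have the same degree.\<close>
  define v where "v = Poly_Mapping.single (2::nat) \<alpha> + Poly_Mapping.single 3 \<beta>"
  define v' where "v' = Poly_Mapping.single (1::nat) ((t + 1) * Q * c0) + Poly_Mapping.single 4 1"
  have v_exps: "v \<in> exps n" "v' \<in> exps n" unfolding v_def v'_def using n4 by simp_all
  have v_deg: "wdeg n w v = D" unfolding v_def D_def wdeg_add using n4 w2 w3 by simp
  have v'_deg: "wdeg n w v' = D"
  proof -
    have "int (wdeg n w v') = (int t + 1) * QQ * int (c0 * w 1) + W3"
      unfolding v'_def wdeg_add ints using n4 w4 by (simp add: algebra_simps)
    then have "int (wdeg n w v') = int D" unfolding D_alt c0(2)[symmetric] ints .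
    then show ?thesis by linarith
  qed
  \<comment> \<open>\<open>F (3 d) = (L^2 - Q) F d\<close>, and \<open>a\<close>, a multiple of
    \<open>d\<close> other than \<open>d\<close> and \<open>2 d\<close>, is at least
    \<open>3 d\<close>.\<close>
  have modulus: "z = 0 \<or> LL\<^sup>2 - QQ \<le> \<bar>z\<bar>" if "int (w 1) dvd z * W1" for z
  proof -
    have d3: "d + 2 * d = 3 * d" "d + d = 2 * d" by simp_all
    have "int (F (3 * d)) = (LL\<^sup>2 - QQ) * int (F d)"
      using pq_fib_step[OF pos(3), of p q d, unfolded d3] pq_fib_double[OF pos(3), of p q] d_even
      unfolding ints Q_def by (simp add: algebra_simps power2_eq_square)
    moreover have "F (3 * d) \<le> F a"
    proof (rule pq_fib_mono[OF pq(1)])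
      obtain m where m: "a = d * m" using a(2) by blast
      have "m \<noteq> 0" "m \<noteq> 1" "m \<noteq> 2" using m a(1) da pos by auto
      then have "3 \<le> m" by linarith
      then show "3 * d \<le> a" using m by simp
    qed
    moreover have "z = 0 \<or> int (F a) \<le> \<bar>z\<bar> * int (F d)"
      using multiple_W_1_dvd[OF a(2)] that unfolding ints by blast
    moreover have "int (F d) > 0" using pq pos pq_fib_pos[of p d q] by simp
    ultimately have "z = 0 \<or> (LL\<^sup>2 - QQ) * int (F d) \<le> \<bar>z\<bar> * int (F d)" by linarith
    then show ?thesis using \<open>int (F d) > 0\<close> by (metis mult_right_le_imp_le)
  qed
  have v_unique: "x1 = 0 \<and> x2 = \<alpha> \<and> x3 = \<beta> \<and> x4 = 0"
    if eq: "x1 * w 1 + x2 * W 1 + x3 * W 2 + x4 * W 3 = D" and x23: "x2 > 0 \<or> x3 > 0" for x1 x2 x3 x4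
  proof -
    define y1 y2 y3 y4 where y: "y1 = int x1" "y2 = int x2" "y3 = int x3" "y4 = int x4"
    have y_nonneg: "y1 \<ge> 0" "y2 \<ge> 0" "y3 \<ge> 0" "y4 \<ge> 0" unfolding y by auto
    have ieq: "y1 * int (w 1) + y2 * W1 + y3 * W2 + y4 * W3 = int D"
      using eq[THEN arg_cong[where f = int]] unfolding y ints by simp
    have D_v: "int D = int \<alpha> * W1 + int \<beta> * W2" unfolding D_def ints by simp
    have \<alpha>\<beta>: "int \<alpha> + LL * int \<beta> = LL\<^sup>2 - QQ"
      unfolding \<alpha> \<beta> iQ ints by (simp add: algebra_simps power2_eq_square)
    \<comment> \<open>Modulo \<open>w 1\<close> one has \<open>W 0 = 0\<close>,
      \<open>W 2 = L W 1\<close> and \<open>W 3 = (L^2 - Q) W 1\<close>, so the degree is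
      \<open>N + y4 (L^2 - Q)\<close> copies of \<open>W 1\<close>. For \<open>v\<close> the value
      of \<open>N\<close> is \<open>L^2 - Q\<close>.\<close>
    define N where "N = y2 + LL * y3"
    have "N > 0"
      using x23 LLp y_nonneg unfolding N_def y
      by (auto intro: add_pos_nonneg add_nonneg_pos)
    \<comment> \<open>Since \<open>W 2 <= L W 1\<close>, a large \<open>N\<close> forces a large
      degree.\<close>
    have weight: "N * W2 \<le> LL * (y2 * W1 + y3 * W2)"
    proof -
      have "0 \<le> y2 * (QQ * W0)" using y_nonneg QQp ipos by simp
      then have "y2 * W2 \<le> y2 * (LL * W1)" unfolding irec(1) by (simp add: right_diff_distrib)
      then show ?thesis unfolding N_def by (simp add: algebra_simps)
    qed
    have U: "(LL\<^sup>2 - QQ) * W2 \<ge> LL * W3"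
    proof -
      have "(LL\<^sup>2 - QQ) * W2 - LL * W3 = QQ * (QQ * W0)"
        unfolding irec by (simp add: algebra_simps power2_eq_square)
      moreover have "QQ * (QQ * W0) \<ge> 0" using QQp ipos by simp
      ultimately show ?thesis by linarith
    qed
    have N_large: "k * W3 \<le> y2 * W1 + y3 * W2" if "k * (LL\<^sup>2 - QQ) \<le> N" "k \<ge> 0" for k
    proof -
      have "LL * (k * W3) = k * (LL * W3)" by simp
      also have "\<dots> \<le> k * ((LL\<^sup>2 - QQ) * W2)" using U \<open>k \<ge> 0\<close> by (rule mult_left_mono)
      also have "\<dots> = (k * (LL\<^sup>2 - QQ)) * W2" by simp
      also have "\<dots> \<le> N * W2" using that(1) ipos by (intro mult_right_mono) auto
      also have "\<dots> \<le> LL * (y2 * W1 + y3 * W2)" by (rule weight)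
      finally show ?thesis using LLp by simp
    qed
    have dvd: "int (w 1) dvd (N + y4 * (LL\<^sup>2 - QQ) - (LL\<^sup>2 - QQ)) * W1"
    proof -
      have W0d: "W0 = int c0 * int (w 1)" unfolding ints c0(2) by simp
      have "(N + y4 * (LL\<^sup>2 - QQ) - (int \<alpha> + LL * int \<beta>)) * W1
            - (W0 * (QQ * (y3 - int \<beta>) + y4 * LL * QQ) - y1 * int (w 1))
          = y1 * int (w 1) + (y2 - int \<alpha>) * W1 + (y3 - int \<beta>) * W2 + y4 * W3"
        unfolding irec N_def by (simp add: algebra_simps power2_eq_square)
      also have "\<dots> = 0" using ieq D_v by (simp add: algebra_simps)
      finally have "(N + y4 * (LL\<^sup>2 - QQ) - (int \<alpha> + LL * int \<beta>)) * W1
          = W0 * (QQ * (y3 - int \<beta>) + y4 * LL * QQ) - y1 * int (w 1)"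
        by (simp only: right_minus_eq)
      also have "\<dots> = int (w 1) * (int c0 * (QQ * (y3 - int \<beta>) + y4 * LL * QQ) - y1)"
        unfolding W0d by (simp add: algebra_simps)
      finally show ?thesis unfolding \<alpha>\<beta> by simp
    qed
    have y1w: "y1 * int (w 1) \<ge> 0" using y_nonneg by simp
    have rest: "y2 * W1 + y3 * W2 \<ge> 0" using y_nonneg ipos by simp
    \<comment> \<open>The first bound says \<open>D < 2 W 3\<close>; it excludes two copies of
      \<open>W 3\<close>, whether real or forced by \<open>N\<close> through
      \<open>N_large\<close>.\<close>
    have "y4 < 2"
    proof (rule ccontr)
      assume "\<not> y4 < 2"
      then have "2 * W3 \<le> y4 * W3" using ipos by simp
      then show False using ieq y1w rest D_alt bounds(1) by linarith
    qed
    moreover have "y4 \<noteq> 1"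
    proof
      assume "y4 = 1"
      then have "LL\<^sup>2 - QQ \<le> N" using modulus[OF dvd] \<open>N > 0\<close> by simp
      then have "W3 \<le> y2 * W1 + y3 * W2" using N_large[of 1] by simp
      moreover have "y4 * W3 = W3" using \<open>y4 = 1\<close> by simp
      ultimately show False using ieq y1w D_alt bounds(1) by linarith
    qed
    ultimately have y4: "y4 = 0" using y_nonneg by linarith
    have "N < 2 * (LL\<^sup>2 - QQ)"
    proof (rule ccontr)
      assume "\<not> ?thesis"
      then have "2 * W3 \<le> y2 * W1 + y3 * W2" using N_large[of 2] by simp
      moreover have "y4 * W3 = 0" using y4 by simp
      ultimately show False using ieq y1w D_alt bounds(1) by linarith
    qed
    then have N: "N = LL\<^sup>2 - QQ" using modulus[OF dvd] \<open>N > 0\<close> y4 by auto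
    \<comment> \<open>With \<open>N\<close> fixed only the shift by \<open>(L s, - s)\<close> is
      left. It changes the degree by a multiple of \<open>Q W 0\<close>, so \<open>s <= 0\<close>,
      while \<open>s < 0\<close> would make \<open>y2\<close> negative.\<close>
    define s where "s = int \<beta> - y3"
    have y2: "y2 = int \<alpha> + LL * s" using N \<alpha>\<beta> unfolding N_def s_def by (simp add: algebra_simps)
    have y3: "y3 = int \<beta> - s" unfolding s_def by simp
    have "y1 * int (w 1) = s * (W2 - LL * W1)"
      using ieq unfolding y2 y3 y4 D_v by (simp add: algebra_simps)
    then have s1: "y1 * int (w 1) = - (s * (QQ * W0))" unfolding irec(1) by (simp add: algebra_simps)
    have "s \<le> 0"
    proof (rule ccontr)
      assume "\<not> s \<le> 0"
      then have "s * (QQ * W0) > 0" using QQp ipos by simp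
      then show False using s1 y1w by linarith
    qed
    moreover have "s \<ge> 0"
    proof (rule ccontr)
      assume "\<not> s \<ge> 0"
      then have "LL * s \<le> LL * (-1)" using LLp by (intro mult_left_mono) auto
      then show False using y2 y_nonneg \<alpha>(3) unfolding ints by linarith
    qed
    ultimately have "s = 0" by simp
    then have "y1 * int (w 1) = 0" using s1 by simp
    then have "y1 = 0" using w_pos[of 1] n by auto
    then show ?thesis using \<open>s = 0\<close> y2 y3 y4 unfolding y by simp
  qed
  have v_isolated: "isolated n w v"
    unfolding isolated_def
  proof (intro ballI impI, elim conjE)
    fix u assume u: "u \<in> exps n" "wdeg n w u = wdeg n w v" "u \<noteq> v"
    let ?u = "Poly_Mapping.lookup u"
    have deg: "D = ?u 1 * w 1 + ?u 2 * W 1 + ?u 3 * W 2 + ?u 4 * W 3 + (\<Sum>i=5..n. ?u i * w i)"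
    proof -
      have "{1..n} = {1, 2, 3, 4} \<union> {5..n}" using n4 by auto
      then have "wdeg n w u = (\<Sum>i\<in>{1, 2, 3, 4}. ?u i * w i) + (\<Sum>i=5..n. ?u i * w i)"
        unfolding wdeg_def by (simp only:) (rule sum.union_disjoint, auto)
      then show ?thesis using u(2) v_deg w2 w3 w4 by simp
    qed
    \<comment> \<open>By the second bound every weight from the fifth on exceeds
      \<open>D\<close>.\<close>
    have u5: "?u i = 0" if i: "i \<in> {5..n}" for i
    proof (rule ccontr)
      assume "?u i \<noteq> 0"
      have "W 4 \<le> w i" using w[of i] i by (auto intro!: pq_fib_mono pq)
      also have "\<dots> \<le> ?u i * w i" using \<open>?u i \<noteq> 0\<close> by simp
      also have "\<dots> \<le> (\<Sum>i=5..n. ?u i * w i)" by (rule member_le_sum[OF i]) auto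
      also have "\<dots> \<le> D" using deg by linarith
      finally have "W4 \<le> int D" unfolding ints by simp
      then show False using D_alt bounds(2) by linarith
    qed
    have "\<not> (?u 2 > 0 \<or> ?u 3 > 0)"
    proof
      assume x23: "?u 2 > 0 \<or> ?u 3 > 0"
      have "?u 1 * w 1 + ?u 2 * W 1 + ?u 3 * W 2 + ?u 4 * W 3 = D" using deg u5 by simp
      from v_unique[OF this x23] have x: "?u 1 = 0" "?u 2 = \<alpha>" "?u 3 = \<beta>" "?u 4 = 0" by auto
      have "u = v"
      proof (rule exps_eqI[OF u(1) v_exps(1)])
        fix i assume "i \<in> {1..n}"
        then consider "i = 1" | "i = 2" | "i = 3" | "i = 4" | "i \<in> {5..n}" by fastforce
        then show "?u i = Poly_Mapping.lookup v i"
          by cases (use x u5 in \<open>auto simp: v_def lookup_add lookup_single when_def\<close>)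
      qed
      then show False using u(3) by simp
    qed
    then show "Poly_Mapping.keys u \<inter> Poly_Mapping.keys v = {}"
      unfolding v_def by (auto simp: in_keys_iff lookup_add lookup_single when_def split: if_splits)
  qed
  define \<tau> where "\<tau> i = Poly_Mapping.single i (crit n w i)" for i
  define T where "T = insert v (\<tau> ` {2..n})"
  have c_pos: "crit n w i > 0" if "i \<in> {1..n}" for i using crit_props(1)[where w = w, OF w_pos that] n by simp
  have inj: "inj_on \<tau> {2..n}"
  proof (rule inj_onI)
    fix i j assume ij: "i \<in> {2..n}" "j \<in> {2..n}" "\<tau> i = \<tau> j"
    have "Poly_Mapping.lookup (\<tau> i) i \<noteq> 0" using c_pos[of i] ij(1) unfolding \<tau>_def by simp
    then have "Poly_Mapping.lookup (\<tau> j) i \<noteq> 0" using ij(3) by simp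
    then show "i = j" unfolding \<tau>_def by (auto simp: lookup_single when_def split: if_splits)
  qed
  have v_notin: "v \<notin> \<tau> ` {2..n}"
  proof
    assume "v \<in> \<tau> ` {2..n}"
    then obtain i where i: "v = \<tau> i" by blast
    have "Poly_Mapping.lookup v 2 \<noteq> 0" "Poly_Mapping.lookup v 3 \<noteq> 0"
      unfolding v_def using \<alpha> \<beta> by (simp_all add: lookup_add lookup_single)
    then show False unfolding i \<tau>_def by (auto simp: lookup_single when_def split: if_splits)
  qed
  \<comment> \<open>No monomial of \<open>T\<close> contains \<open>x_1\<close>, but
    \<open>v'\<close> does, so \<open>v'\<close> is a partner outside \<open>T\<close>.\<close>
  have T_1: "Poly_Mapping.lookup u 1 = 0" if "u \<in> T" for u
    using that unfolding T_def v_def \<tau>_def by (auto simp: lookup_add lookup_single)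
  have v'_T: "v' \<notin> T"
  proof
    assume "v' \<in> T"
    from T_1[OF this] show False unfolding v'_def using c0 Q by (simp add: lookup_add)
  qed
  show ?thesis
  proof (rule not_toric_complete_intersectionI)
    show "n > 0" "finite T" "T \<subseteq> exps n" using n v_exps unfolding T_def \<tau>_def by auto
    show "card T = n" unfolding T_def using v_notin card_image[OF inj] n by simp
    fix \<sigma> assume "\<sigma> \<in> T"
    then consider "\<sigma> = v" | i where "i \<in> {2..n}" "\<sigma> = \<tau> i" unfolding T_def by blast
    then show "isolated n w \<sigma>"
    proof cases
      case 2
      then show ?thesis unfolding \<tau>_def using isolated_crit[where w = w, OF w_pos] by auto
    qed (use v_isolated in simp)
    from \<open>\<sigma> \<in> T\<close> consider "\<sigma> = v" | i where "i \<in> {2..n}" "\<sigma> = \<tau> i" unfolding T_def by blast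
    then show "\<exists>u\<in>exps n - T. wdeg n w u = wdeg n w \<sigma>"
    proof cases
      case 1
      then show ?thesis using v'_T v'_deg v_deg v_exps by (intro bexI[of _ v']) auto
    next
      case (2 i)
      then have i: "i \<in> {1..n}" by auto
      obtain u where u: "u \<in> exps n" "Poly_Mapping.lookup u i = 0" "wdeg n w u = crit n w i * w i"
        using crit_props(2)[where w = w, OF w_pos i] n by auto
      have \<sigma>_deg: "wdeg n w \<sigma> = crit n w i * w i" unfolding 2(2) \<tau>_def using i by simp
      have "u \<notin> \<tau> ` {2..n}"
      proof
        assume "u \<in> \<tau> ` {2..n}"
        then obtain j where j: "j \<in> {2..n}" "u = \<tau> j" by blast
        then have "crit n w j * w j = crit n w i * w i" using u(3) unfolding \<tau>_def by simp
        moreover have "j \<noteq> i" using u(2) j c_pos[of j] unfolding \<tau>_def by auto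
        ultimately show False
          using crit_degrees_distinct[of i j] crit_degrees_distinct[of j i] 2(1) j(1)
          by (metis atLeastAtMost_iff linorder_neqE_nat)
      qed
      then show ?thesis
      proof (cases "u = v")
        \<comment> \<open>The critical degree of \<open>x_i\<close> may equal \<open>D\<close> with
          \<open>v\<close> itself as the partner found; \<open>v'\<close> then serves
          instead.\<close>
        case True
        then show ?thesis using v'_T v'_deg v_deg v_exps u(3) \<sigma>_deg by (intro bexI[of _ v']) auto
      next
        case False
        then show ?thesis using \<open>u \<notin> \<tau> ` {2..n}\<close> u \<sigma>_deg unfolding T_def by (intro bexI[of _ u]) auto
      qed
    qed
  qed
qed

end

theorem theorem4p5:
  fixes p q h a d n :: nat
    and w :: "nat \<Rightarrow> nat"
  assumes "p > 0" and "q > 0" and "coprime p q"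
    and "h > 0" and "a > 0" and "d > 0" and "n \<ge> 3"
    and "w 1 = pq_fib p q a"
    and "\<And>i. i \<in> {2..n} \<Longrightarrow> w i = pq_fib p q (h * a + (i - 1) * d)"
  shows "toric_complete_intersection TYPE('k::field) n w \<longleftrightarrow>
      odd d \<or>
      d \<ge> a \<or>
      a = 2 * d \<or>
      (int (gcd a d) = int a - int d \<and> odd a) \<or>
      (n = 3 \<and> 2 * d dvd a)"
proof (rule iffI)
  assume ci: "toric_complete_intersection TYPE('k::field) n w"
  show "odd d \<or> d \<ge> a \<or> a = 2 * d \<or> (int (gcd a d) = int a - int d \<and> odd a) \<or> (n = 3 \<and> 2 * d dvd a)"
  proof (rule ccontr)
    assume "\<not> ?thesis"
    then have neg: "even d" "d < a" "a \<noteq> 2 * d" "\<not> (int (gcd a d) = int a - int d \<and> odd a)"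
      "\<not> (n = 3 \<and> 2 * d dvd a)" by auto
    show False
    proof (cases "n = 3 \<or> \<not> d dvd a")
      case True
      then show False
        using not_complete_intersection_few[OF assms(1-9) neg] ci by blast
    next
      case False
      then have "d dvd a" "n \<ge> 4" using \<open>n \<ge> 3\<close> by auto
      then show False
        using not_complete_intersection_many[OF assms(1-9) neg(1-3)] ci by blast
    qed
  qed
qed (rule toric_complete_intersection_pq_fib[OF assms(1-9)])

end
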